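(* Let $V$ be the set of six properties of functions $g:\omega\to\omega$: edc (effectively densely computable), cc (coarsely computable), gc (generically computable), dc (densely computable), ``$\alpha=1$'' (meaning $\alpha(g)=1$), and ``$\gamma=1$'' (meaning $\gamma(g)=1$). Consider the directed graph on $V$ with exactly the edges edc$\to$cc, edc$\to$gc, cc$\to$dc, gc$\to$dc, gc$\to$($\alpha=1$), dc$\to$($\gamma=1$), ($\alpha=1$)$\to$($\gamma=1$). For $p,q\in V$ write $q\le p$ if $p=q$ or there is a directed path from $p$ to $q$. Let $P,Q\subseteq V$. Then the following are equivalent: (i) there is a c.e. set $C\subseteq\omega$ (identified with its characteristic function) that satisfies every $p\in P$ and no $q\in Q$; (ii) there is a set $C\subseteq\omega$ that satisfies every $p\in P$ and no $q\in Q$; (iii) there is a function $g:\omega\to\omega$ that satisfies every $p\in P$ and no $q\in Q$; (iv) there do not exist $p\in P$ and $q\in Q$ with $q\le p$.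
   Context: For $A\subseteq\omega$, $\rho_n(A)=|A\cap\{0,\dots,n-1\}|/n$; the lower density is $\underline{\rho}(A)=\liminf_n\rho_n(A)$, the upper density $\overline{\rho}(A)=\limsup_n\rho_n(A)$, and if they are equal their common value is the density $\rho(A)$. Let $g:\omega\to\omega$. A partial description of $g$ is a partial function $f$ with $f(n)=g(n)$ whenever $f(n)$ is defined; a generic description is a partial description whose domain has density $1$; $g$ is generically computable if it has a partial computable generic description. A coarse description of $g$ is a total $f$ with $\rho(\{n:f(n)=g(n)\})=1$; $g$ is coarsely computable if it has a computable coarse description. A dense description of $g$ is a partial $f$ with $\rho(\{n: f(n)=g(n)\})=1$; $g$ is densely computable if it has a partial computable dense description. A strong partial description of $g$ is a total $f:\omega\to\omega\cup\{\square\}$ with $f(n)=g(n)$ whenever $f(n)\ne\square$ (the set $f^{-1}(\omega)$ is its strong domain); an effective dense description is a strong partial description with strong domain of density $1$; $g$ is effectively densely computable if it has a computable effective dense description. $\alpha(g)$ is the supremum of those $r$ such that some partial computable partial description $f$ of $g$ has $\underline{\rho}(\mathrm{dom} f)\ge r$. $\gamma(g)$ is the supremum of those $r$ such that some total computable $f$ has $\underline{\rho}(\{n:f(n)=g(n)\})\ge r$. *)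

theory Defs
  imports Complex_Main "HOL-Library.Extended_Real" "HOL-Library.Liminf_Limsup"
    "HOL-Library.Indicator_Function"
begin

section \<open>Partial computable functions\<close>

text \<open>
  Kleene's partial recursive functions. Terms carry no arity annotation: \<^term>\<open>xs\<close> is the argument
  tuple, and a term applied to a tuple of an unsuitable length is undefined there, so that on tuples
  of any fixed length every term denotes a partial recursive function of that arity.
\<close>

datatype recf =
    Zero
  | Succ
  | Proj nat
  | Comp recf "recf list"
  | PRec recf recf
  | Mu recf

text \<open>
  Composition is strict in all inner functions, and \<^term>\<open>Mu e\<close> yields \<^term>\<open>n\<close> only if \<^term>\<open>e\<close> is
  defined (and nonzero) at all smaller arguments.
\<close>

fun eval :: "recf \<Rightarrow> nat list \<Rightarrow> nat option" where
  "eval Zero xs = Some 0"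
| "eval Succ xs = (case xs of [x] \<Rightarrow> Some (Suc x) | _ \<Rightarrow> None)"
| "eval (Proj i) xs = (if i < length xs then Some (xs ! i) else None)"
| "eval (Comp e es) xs =
     (case those (map (\<lambda>d. eval d xs) es) of None \<Rightarrow> None | Some ys \<Rightarrow> eval e ys)"
| "eval (PRec e d) xs =
     (case xs of
        [] \<Rightarrow> None
      | n # ys \<Rightarrow>
          rec_nat (eval e ys)
            (\<lambda>m r. case r of None \<Rightarrow> None | Some y \<Rightarrow> eval d (m # y # ys)) n)"
| "eval (Mu e) xs =
     (if \<exists>n. eval e (n # xs) = Some 0 \<and> (\<forall>m<n. \<exists>y. eval e (m # xs) = Some (Suc y))
      then Some (LEAST n. eval e (n # xs) = Some 0) else None)"

definition partial_computable :: "(nat \<rightharpoonup> nat) \<Rightarrow> bool" where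
  "partial_computable f \<longleftrightarrow> (\<exists>e. \<forall>n. eval e [n] = f n)"

definition computable :: "(nat \<Rightarrow> nat) \<Rightarrow> bool" where
  "computable f \<longleftrightarrow> partial_computable (\<lambda>n. Some (f n))"

definition ce_set :: "nat set \<Rightarrow> bool" where
  "ce_set C \<longleftrightarrow> (\<exists>f. partial_computable f \<and> dom f = C)"

section \<open>Asymptotic density\<close>

text \<open>The value at \<^term>\<open>n = 0\<close> is \<open>0 / 0 = 0\<close>; it does not affect the limits below.\<close>

definition rho :: "nat \<Rightarrow> nat set \<Rightarrow> real" where
  "rho n A = real (card (A \<inter> {0..<n})) / real n"

definition lower_density :: "nat set \<Rightarrow> ereal" where
  "lower_density A = liminf (\<lambda>n. ereal (rho n A))"

definition upper_density :: "nat set \<Rightarrow> ereal" where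
  "upper_density A = limsup (\<lambda>n. ereal (rho n A))"

definition has_density :: "nat set \<Rightarrow> real \<Rightarrow> bool" where
  "has_density A d \<longleftrightarrow> lower_density A = ereal d \<and> upper_density A = ereal d"

section \<open>Descriptions\<close>

definition partial_description :: "(nat \<rightharpoonup> nat) \<Rightarrow> (nat \<Rightarrow> nat) \<Rightarrow> bool" where
  "partial_description f g \<longleftrightarrow> (\<forall>n\<in>dom f. f n = Some (g n))"

definition generic_description :: "(nat \<rightharpoonup> nat) \<Rightarrow> (nat \<Rightarrow> nat) \<Rightarrow> bool" where
  "generic_description f g \<longleftrightarrow> partial_description f g \<and> has_density (dom f) 1"

definition generically_computable :: "(nat \<Rightarrow> nat) \<Rightarrow> bool" where
  "generically_computable g \<longleftrightarrow> (\<exists>f. partial_computable f \<and> generic_description f g)"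

definition coarse_description :: "(nat \<Rightarrow> nat) \<Rightarrow> (nat \<Rightarrow> nat) \<Rightarrow> bool" where
  "coarse_description f g \<longleftrightarrow> has_density {n. f n = g n} 1"

definition coarsely_computable :: "(nat \<Rightarrow> nat) \<Rightarrow> bool" where
  "coarsely_computable g \<longleftrightarrow> (\<exists>f. computable f \<and> coarse_description f g)"

definition dense_description :: "(nat \<rightharpoonup> nat) \<Rightarrow> (nat \<Rightarrow> nat) \<Rightarrow> bool" where
  "dense_description f g \<longleftrightarrow> has_density {n. f n = Some (g n)} 1"

definition densely_computable :: "(nat \<Rightarrow> nat) \<Rightarrow> bool" where
  "densely_computable g \<longleftrightarrow> (\<exists>f. partial_computable f \<and> dense_description f g)"

text \<open>
  The set \<open>\<omega> \<union> {\<box>}\<close>. Unlike undefinedness of a partial function (\<^term>\<open>None\<close>), \<^term>\<open>Box\<close> is an actual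
  output value; computability of functions into this type is taken along the bijection \<open>box_code\<close>.
\<close>

datatype box_nat = Box | Val nat

primrec box_code :: "box_nat \<Rightarrow> nat" where
  "box_code Box = 0"
| "box_code (Val k) = Suc k"

definition computable_box :: "(nat \<Rightarrow> box_nat) \<Rightarrow> bool" where
  "computable_box f \<longleftrightarrow> computable (\<lambda>n. box_code (f n))"

definition strong_partial_description :: "(nat \<Rightarrow> box_nat) \<Rightarrow> (nat \<Rightarrow> nat) \<Rightarrow> bool" where
  "strong_partial_description f g \<longleftrightarrow> (\<forall>n. f n \<noteq> Box \<longrightarrow> f n = Val (g n))"

definition strong_domain :: "(nat \<Rightarrow> box_nat) \<Rightarrow> nat set" where
  "strong_domain f = f -` range Val"

definition effective_dense_description :: "(nat \<Rightarrow> box_nat) \<Rightarrow> (nat \<Rightarrow> nat) \<Rightarrow> bool" where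
  "effective_dense_description f g \<longleftrightarrow>
     strong_partial_description f g \<and> has_density (strong_domain f) 1"

definition effectively_densely_computable :: "(nat \<Rightarrow> nat) \<Rightarrow> bool" where
  "effectively_densely_computable g \<longleftrightarrow>
     (\<exists>f. computable_box f \<and> effective_dense_description f g)"

text \<open>
  The sets of which the suprema are taken contain \<open>0\<close> and are bounded above by \<open>1\<close>, so the
  conditionally complete \<^term>\<open>Sup\<close> on the reals is the actual supremum.
\<close>

definition alpha :: "(nat \<Rightarrow> nat) \<Rightarrow> real" where
  "alpha g = Sup {r. \<exists>f. partial_computable f \<and> partial_description f g \<and>
                         ereal r \<le> lower_density (dom f)}"

definition gamma :: "(nat \<Rightarrow> nat) \<Rightarrow> real" where
  "gamma g = Sup {r. \<exists>f. computable f \<and> ereal r \<le> lower_density {n. f n = g n}}"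

section \<open>The graph of properties\<close>

datatype property = EDC | CC | GC | DC | Alpha1 | Gamma1

primrec satisfies :: "(nat \<Rightarrow> nat) \<Rightarrow> property \<Rightarrow> bool" where
  "satisfies g EDC \<longleftrightarrow> effectively_densely_computable g"
| "satisfies g CC \<longleftrightarrow> coarsely_computable g"
| "satisfies g GC \<longleftrightarrow> generically_computable g"
| "satisfies g DC \<longleftrightarrow> densely_computable g"
| "satisfies g Alpha1 \<longleftrightarrow> alpha g = 1"
| "satisfies g Gamma1 \<longleftrightarrow> gamma g = 1"

definition edges :: "(property \<times> property) set" where
  "edges = {(EDC, CC), (EDC, GC), (CC, DC), (GC, DC), (GC, Alpha1), (DC, Gamma1), (Alpha1, Gamma1)}"

definition below :: "property \<Rightarrow> property \<Rightarrow> bool" (infix "\<preceq>" 50) where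
  "q \<preceq> p \<longleftrightarrow> p = q \<or> (p, q) \<in> edges\<^sup>+"

definition separates :: "(nat \<Rightarrow> nat) \<Rightarrow> property set \<Rightarrow> property set \<Rightarrow> bool" where
  "separates g P Q \<longleftrightarrow> (\<forall>p\<in>P. satisfies g p) \<and> (\<forall>q\<in>Q. \<not> satisfies g q)"

end

theory Submission
  imports Defs "HOL-Library.Nat_Bijection"
begin

text \<open>
  Interleaving two sets on the even and the odd numbers produces a set satisfying exactly the
  properties that both satisfy. It therefore suffices to find, for each property \<open>q\<close>, a c.e. set that
  satisfies precisely the properties not implying \<open>q\<close>. The six diagonalisations use the columns
  \<open>{n. col n = e}\<close> (the numbers with exactly \<open>e\<close> factors \<open>2\<close>), which have positive density and
  whose tails are uniformly small, cut into the dyadic blocks \<open>{2 ^ s..<2 ^ (s + 1)}\<close>; column \<open>e\<close> is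
  devoted to defeating the \<open>e\<close>-th partial computable function. Among the implications only those
  into \<open>\<gamma> = 1\<close> need an argument: a partial function that is correct on most of each long block
  is waited for until it has converged on most of the block.
\<close>

section \<open>Computable functions and decidable predicates\<close>

text \<open>Columns alone cannot refute \<alpha> = 1 or \<gamma> = 1: column \<open>e\<close> has
  density \<open>2 ^ -(e+1)\<close>, so failing there costs a program ever less as \<open>e\<close>
  grows. For \<gamma> whole blocks are therefore assigned to a program, and for \<alpha> a simple
  set in the style of Post confines every correct partial function, up to finitely many points, to a
  null set. The same weakness lets gc and dc fail while \<alpha> = 1 survives: finitely many columns
  can be decided ad hoc, without uniformity in \<open>e\<close>. For cc and edc the obstacle is that
  a program need not be total: waiting for it on too many cells would leave a set of positive
  density undecided. Attacks are confined to expansionary cells, of which a nontotal program has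
  only finitely many. Since the sets must be c.e., each construction reacts only to outputs seen at
  a finite stage. As the minimisation clause of \<open>eval\<close> quantifies over all numbers, a
  decidable step-bounded form is obtained from finite sets of evaluation judgements.\<close>

definition pair :: "nat \<Rightarrow> nat \<Rightarrow> nat" where
  "pair a b = prod_encode (a, b)"

definition pi1 :: "nat \<Rightarrow> nat" where
  "pi1 z = fst (prod_decode z)"

definition pi2 :: "nat \<Rightarrow> nat" where
  "pi2 z = snd (prod_decode z)"

lemma pi1_pair [simp]: "pi1 (pair a b) = a"
  and pi2_pair [simp]: "pi2 (pair a b) = b"
  and pair_pi [simp]: "pair (pi1 z) (pi2 z) = z"
  by (simp_all add: pi1_def pi2_def pair_def)

lemma pair_eq_iff [simp]: "pair a b = pair c d \<longleftrightarrow> a = c \<and> b = d"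
  by (metis pi1_pair pi2_pair)

lemma le_pair1: "a \<le> pair a b" and le_pair2: "b \<le> pair a b"
  by (simp_all add: pair_def le_prod_encode_1 le_prod_encode_2)

definition decidable :: "(nat \<Rightarrow> bool) \<Rightarrow> bool" where
  "decidable P \<longleftrightarrow> computable (\<lambda>x. of_bool (P x))"

lemma computable_iff: "computable f \<longleftrightarrow> (\<exists>e. \<forall>n. eval e [n] = Some (f n))"
  by (simp add: computable_def partial_computable_def)

lemma computable_id: "computable (\<lambda>x. x)"
  unfolding computable_iff by (rule exI[of _ "Proj 0"]) simp

lemma computable_comp:
  assumes "computable f" "computable A"
  shows "computable (\<lambda>x. f (A x))"
proof -
  obtain e d where "\<forall>n. eval e [n] = Some (f n)" "\<forall>n. eval d [n] = Some (A n)"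
    using assms by (auto simp: computable_iff)
  then show ?thesis
    unfolding computable_iff by (intro exI[of _ "Comp e [d]"]) simp
qed

lemma computable_Suc: "computable A \<Longrightarrow> computable (\<lambda>x. Suc (A x))"
  by (rule computable_comp[of Suc]) (auto simp: computable_iff intro: exI[of _ Succ])

lemma computable_const: "computable (\<lambda>x. c)"
proof (induction c)
  case 0
  show ?case unfolding computable_iff by (rule exI[of _ Zero]) simp
next
  case (Suc c)
  then show ?case by (rule computable_Suc)
qed

lemma computable_binary:
  assumes e: "\<And>a b. eval e [a, b] = Some (h a b)" and "computable A" "computable B"
  shows "computable (\<lambda>x. h (A x) (B x))"
proof -
  obtain c d where "\<forall>n. eval c [n] = Some (A n)" "\<forall>n. eval d [n] = Some (B n)"
    using assms by (auto simp: computable_iff)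
  then show ?thesis
    unfolding computable_iff by (intro exI[of _ "Comp e [c, d]"]) (simp add: e)
qed

section \<open>Programs for arithmetic and Cantor pairing\<close>

definition r_add :: recf where
  "r_add = PRec (Proj 0) (Comp Succ [Proj 1])"

definition r_pred :: recf where
  "r_pred = PRec Zero (Proj 0)"

definition r_monus :: recf where
  "r_monus = PRec (Proj 0) (Comp r_pred [Proj 1])"

definition r_triangle :: recf where
  "r_triangle = PRec Zero (Comp r_add [Comp Succ [Proj 0], Proj 1])"

definition r_pair :: recf where
  "r_pair = Comp r_add [Comp r_triangle [r_add], Proj 0]"

text \<open>Inverts the pairing \<open>z = triangle (a + b) + a\<close>: the diagonal
  \<open>a + b\<close> is the least \<open>k\<close> with \<open>z < triangle (k + 1)\<close>, a
  comparison that truncated subtraction turns into a test for 0. Both projections follow from the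
  diagonal by subtraction.\<close>

definition r_diag :: recf where
  "r_diag = Mu (Comp r_monus [Comp r_triangle [Comp Succ [Proj 0]], Comp Succ [Proj 1]])"

lemma eval_r_add: "eval r_add [a, b] = Some (a + b)"
  unfolding r_add_def by (induction a) auto

lemma eval_r_pred: "eval r_pred [a] = Some (a - 1)"
  unfolding r_pred_def by (induction a) auto

text \<open>Arguments are swapped because primitive recursion runs over the first one.\<close>

lemma eval_r_monus: "eval r_monus [a, b] = Some (b - a)"
  unfolding r_monus_def by (induction a) (auto simp: eval_r_pred)

lemma eval_r_triangle: "eval r_triangle [a] = Some (triangle a)"
  unfolding r_triangle_def by (induction a) (auto simp: eval_r_add)

lemma eval_r_pair: "eval r_pair [a, b] = Some (pair a b)"
  unfolding r_pair_def by (simp add: eval_r_add eval_r_triangle pair_def prod_encode_def)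

lemma triangle_mono: "a \<le> b \<Longrightarrow> triangle a \<le> triangle b"
  by (induction b rule: dec_induct) auto

lemma eval_r_diag: "eval r_diag [z] = Some (pi1 z + pi2 z)"
proof -
  obtain a b where z: "z = pair a b" by (metis pair_pi)
  have zz: "z = triangle (a + b) + a" by (simp add: z pair_def prod_encode_def)
  have lt: "z < triangle (Suc (a + b))" by (simp add: zz)
  have ge: "triangle (Suc k) \<le> z" if "k < a + b" for k
    using triangle_mono[of "Suc k" "a + b"] that by (simp add: zz)
  have *: "eval (Comp r_monus [Comp r_triangle [Comp Succ [Proj 0]], Comp Succ [Proj 1]]) [k, z]
      = Some (Suc z - triangle (Suc k))" for k
    by (simp add: eval_r_monus eval_r_triangle del: triangle_Suc)
  have least: "(LEAST k. Suc z - triangle (Suc k) = 0) = a + b"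
  proof (rule Least_equality)
    show "Suc z - triangle (Suc (a + b)) = 0" using lt by simp
    show "a + b \<le> k" if "Suc z - triangle (Suc k) = 0" for k
      using ge[of k] that by (metis Suc_diff_le nat.distinct(1) not_le)
  qed
  have ex: "\<exists>n. Suc z - triangle (Suc n) = 0 \<and> (\<forall>m<n. \<exists>y. Suc z - triangle (Suc m) = Suc y)"
    using lt ge by (intro exI[of _ "a + b"]) (metis Suc_diff_le Suc_leI diff_is_0_eq)
  show ?thesis
    unfolding r_diag_def eval.simps(6) * using ex least by (simp add: z del: triangle_Suc)
qed

lemma computable_add: "computable A \<Longrightarrow> computable B \<Longrightarrow> computable (\<lambda>x. A x + B x)"
  by (rule computable_binary[OF eval_r_add])

lemma computable_diff: "computable A \<Longrightarrow> computable B \<Longrightarrow> computable (\<lambda>x. A x - B x)"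
  by (rule computable_binary[OF eval_r_monus])

lemma computable_pair: "computable A \<Longrightarrow> computable B \<Longrightarrow> computable (\<lambda>x. pair (A x) (B x))"
  by (rule computable_binary[OF eval_r_pair])

lemma pi1_eq: "pi1 z = z - triangle (pi1 z + pi2 z)"
  using pair_pi[of z] unfolding pair_def prod_encode_def by simp

lemma computable_pi1: "computable A \<Longrightarrow> computable (\<lambda>x. pi1 (A x))"
  and computable_pi2: "computable A \<Longrightarrow> computable (\<lambda>x. pi2 (A x))"
proof -
  have d: "computable (\<lambda>z. pi1 z + pi2 z)"
    unfolding computable_iff by (rule exI[of _ r_diag]) (simp add: eval_r_diag)
  have t: "computable triangle"
    unfolding computable_iff by (rule exI[of _ r_triangle]) (simp add: eval_r_triangle)
  have 1: "computable pi1"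
    using computable_diff[OF computable_id computable_comp[OF t d]] by (simp flip: pi1_eq)
  have 2: "computable pi2"
    using computable_diff[OF d 1] by simp
  show "computable A \<Longrightarrow> computable (\<lambda>x. pi1 (A x))"
    by (rule computable_comp[OF 1])
  show "computable A \<Longrightarrow> computable (\<lambda>x. pi2 (A x))"
    by (rule computable_comp[OF 2])
qed

text \<open>The step function receives parameter, counter and accumulator as one nested pair, in
  this order. Conditionals, products, powers and bounded counts are all loops of this form.\<close>

lemma computable_rec_nat:
  assumes "computable a"
    and "computable (\<lambda>z. b (pi1 z) (pi1 (pi2 z)) (pi2 (pi2 z)))"
    and "computable c"
  shows "computable (\<lambda>x. rec_nat (a x) (\<lambda>m r. b x m r) (c x))"
proof -
  obtain ea eb ec where e: "\<forall>n. eval ea [n] = Some (a n)"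
      "\<forall>n. eval eb [n] = Some (b (pi1 n) (pi1 (pi2 n)) (pi2 (pi2 n)))"
      "\<forall>n. eval ec [n] = Some (c n)"
    using assms unfolding computable_iff by blast
  define p where "p = PRec ea (Comp eb [Comp r_pair [Proj 2, Comp r_pair [Proj 0, Proj 1]]])"
  have p: "eval p [k, x] = Some (rec_nat (a x) (\<lambda>m r. b x m r) k)" for k x
    unfolding p_def by (induction k) (auto simp: e eval_r_pair)
  then show ?thesis
    unfolding computable_iff by (intro exI[of _ "Comp p [ec, Proj 0]"]) (simp add: e)
qed

lemma computable_if:
  assumes "decidable P" "computable A" "computable B"
  shows "computable (\<lambda>x. if P x then A x else B x)"
proof -
  \<comment> \<open>The loop runs at most once: zero rounds leave the start value
    \<open>B x\<close>, one round replaces it by \<open>A x\<close>.\<close>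
  have "(\<lambda>x. if P x then A x else B x) = (\<lambda>x. rec_nat (B x) (\<lambda>m r. A x) (of_bool (P x)))"
    by auto
  moreover have "computable \<dots>"
    by (intro computable_rec_nat computable_comp[OF assms(2)] computable_pi1 computable_id assms
        assms(1)[unfolded decidable_def])
  ultimately show ?thesis by simp
qed

lemma computable_mult:
  assumes "computable A" "computable B"
  shows "computable (\<lambda>x. A x * B x)"
proof -
  have "rec_nat 0 (\<lambda>m r. r + b) a = a * b" for a b :: nat
    by (induction a) auto
  moreover have "computable (\<lambda>x. rec_nat 0 (\<lambda>m r. r + B x) (A x))"
    by (intro computable_rec_nat computable_comp[OF assms(2)] computable_pi1 computable_pi2
        computable_id computable_add computable_const assms)
  ultimately show ?thesis by simp
qed

lemma computable_power:
  assumes "computable A" "computable B"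
  shows "computable (\<lambda>x. A x ^ B x)"
proof -
  have "rec_nat 1 (\<lambda>m r. r * a) b = a ^ b" for a b :: nat
    by (induction b) auto
  moreover have "computable (\<lambda>x. rec_nat 1 (\<lambda>m r. r * A x) (B x))"
    by (intro computable_rec_nat computable_comp[OF assms(1)] computable_pi1 computable_pi2
        computable_id computable_mult computable_const assms)
  ultimately show ?thesis by simp
qed

section \<open>Decidable predicates and bounded quantifiers\<close>

lemma decidable_const: "decidable (\<lambda>x. c)"
  unfolding decidable_def by (rule computable_const)

lemma decidable_comp: "decidable P \<Longrightarrow> computable A \<Longrightarrow> decidable (\<lambda>x. P (A x))"
  unfolding decidable_def by (rule computable_comp)

lemma decidable_less:
  assumes "computable A" "computable B"
  shows "decidable (\<lambda>x. A x < B x)"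
proof -
  have "of_bool (a < b) = 1 - (1 - (b - a))" for a b :: nat
    by auto
  then show ?thesis
    unfolding decidable_def using assms by (auto intro!: computable_diff computable_const)
qed

lemma decidable_not: "decidable P \<Longrightarrow> decidable (\<lambda>x. \<not> P x)"
  unfolding decidable_def of_bool_not_iff
  using decidable_less[of "\<lambda>x. of_bool (P x)" "\<lambda>x. 1"] computable_const[of 1]
  by (simp add: decidable_def)

lemma decidable_conj: "decidable P \<Longrightarrow> decidable Q \<Longrightarrow> decidable (\<lambda>x. P x \<and> Q x)"
  unfolding decidable_def of_bool_conj by (rule computable_mult)

lemma decidable_disj: "decidable P \<Longrightarrow> decidable Q \<Longrightarrow> decidable (\<lambda>x. P x \<or> Q x)"
  using decidable_not[OF decidable_conj[OF decidable_not[of P] decidable_not[of Q]]] by simp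

lemma decidable_imp: "decidable P \<Longrightarrow> decidable Q \<Longrightarrow> decidable (\<lambda>x. P x \<longrightarrow> Q x)"
  unfolding imp_conv_disj by (intro decidable_disj decidable_not)

lemma decidable_if:
  "decidable P \<Longrightarrow> decidable Q \<Longrightarrow> decidable R \<Longrightarrow> decidable (\<lambda>x. if P x then Q x else R x)"
  unfolding if_bool_eq_conj by (intro decidable_conj decidable_imp decidable_not)

lemma decidable_le: "computable A \<Longrightarrow> computable B \<Longrightarrow> decidable (\<lambda>x. A x \<le> B x)"
  unfolding not_less[symmetric] by (intro decidable_not decidable_less)

lemma decidable_eq: "computable A \<Longrightarrow> computable B \<Longrightarrow> decidable (\<lambda>x. A x = B x)"
  unfolding order_eq_iff[of "A x" "B x" for x] by (intro decidable_conj decidable_le)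

text \<open>Counting precedes the quantifiers because a bounded existential statement says that a
  count is positive. The counts reappear when majorities in blocks and cells are tested.\<close>

lemma computable_card_less:
  assumes "decidable (\<lambda>z. P (pi1 z) (pi2 z))" "computable B"
  shows "computable (\<lambda>x. card {y. y < B x \<and> P x y})"
proof -
  have "rec_nat 0 (\<lambda>m r. if P x m then Suc r else r) b = card {y. y < b \<and> P x y}" for x b
  proof (induction b)
    case (Suc b)
    have "{y. y < Suc b \<and> P x y} = (if P x b then insert b {y. y < b \<and> P x y} else {y. y < b \<and> P x y})"
      by (auto simp: less_Suc_eq)
    then show ?case using Suc by simp
  qed simp
  moreover have "decidable (\<lambda>z. P (pi1 z) (pi1 (pi2 z)))"
    using decidable_comp[OF assms(1), of "\<lambda>z. pair (pi1 z) (pi1 (pi2 z))"]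
    by (simp add: computable_pair computable_pi1 computable_pi2 computable_id)
  then have "computable (\<lambda>x. rec_nat 0 (\<lambda>m r. if P x m then Suc r else r) (B x))"
    by (intro computable_rec_nat computable_if computable_pi1 computable_pi2
        computable_id computable_const computable_Suc assms)
  ultimately show ?thesis by simp
qed

lemma decidable_bex:
  assumes "decidable (\<lambda>z. P (pi1 z) (pi2 z))" "computable B"
  shows "decidable (\<lambda>x. \<exists>y<B x. P x y)"
proof -
  have "(\<exists>y<b. P x y) \<longleftrightarrow> 0 < card {y. y < b \<and> P x y}" for x b
    by (auto simp: card_gt_0_iff)
  then show ?thesis
    by (simp add: decidable_less computable_const computable_card_less assms)
qed

lemma decidable_ball:
  assumes "decidable (\<lambda>z. P (pi1 z) (pi2 z))" "computable B"
  shows "decidable (\<lambda>x. \<forall>y<B x. P x y)"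
  using decidable_not[OF decidable_bex[OF decidable_not[OF assms(1)] assms(2)]] by simp

text \<open>The inner program is total with values 0 and 1, so the demand of \<open>Mu\<close> for
  nonzero values before the first zero is met automatically.\<close>

lemma eval_Mu_total:
  assumes "\<And>y. eval e (y # xs) = Some (of_bool (\<not> P y))"
  shows "eval (Mu e) xs = (if \<exists>y. P y then Some (LEAST y. P y) else None)"
proof -
  have "(\<exists>n. P n \<and> (\<forall>m<n. \<not> P m)) \<longleftrightarrow> (\<exists>n. P n)"
    by (metis exists_least_iff)
  moreover have "eval e (y # xs) = Some 0 \<longleftrightarrow> P y" "(\<exists>r. eval e (y # xs) = Some (Suc r)) \<longleftrightarrow> \<not> P y" for y
    by (auto simp: assms)
  ultimately show ?thesis
    by simp
qed

text \<open>Kleene normal form: one unbounded search, then a total function of the least witness.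
  Dovetailing is expressed by witnesses that code a value together with a stage.\<close>

lemma partial_computable_search:
  assumes "decidable (\<lambda>z. P (pi1 z) (pi2 z))" "computable (\<lambda>z. F (pi1 z) (pi2 z))"
  shows "partial_computable (\<lambda>x. if \<exists>y. P x y then Some (F x (LEAST y. P x y)) else None)"
proof -
  obtain ef ep where ef: "\<forall>n. eval ef [n] = Some (F (pi1 n) (pi2 n))"
    and ep: "\<forall>n. eval ep [n] = Some (of_bool (\<not> P (pi1 n) (pi2 n)))"
    using decidable_not[OF assms(1)] assms(2) unfolding decidable_def computable_iff by blast
  define m where "m = Mu (Comp ep [Comp r_pair [Proj 1, Proj 0]])"
  have m: "eval m [x] = (if \<exists>y. P x y then Some (LEAST y. P x y) else None)" for x
    unfolding m_def by (rule eval_Mu_total) (simp add: ep eval_r_pair)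
  show ?thesis
    unfolding partial_computable_def
    by (rule exI[of _ "Comp ef [Comp r_pair [Proj 0, m]]"]) (simp add: m ef eval_r_pair)
qed

lemma computable_Least:
  assumes "decidable (\<lambda>z. P (pi1 z) (pi2 z))" "\<And>x. \<exists>y. P x y"
  shows "computable (\<lambda>x. LEAST y. P x y)"
  using partial_computable_search[OF assms(1) computable_pi2[OF computable_id]] assms(2)
  by (simp add: computable_def)

lemmas computable_intros =
  computable_id computable_const computable_Suc computable_add computable_diff computable_mult
  computable_power computable_pair computable_pi1 computable_pi2 computable_if computable_card_less
  decidable_const decidable_less decidable_le decidable_eq decidable_not decidable_conj
  decidable_disj decidable_imp decidable_if decidable_bex decidable_ball

lemma computable_div2: "computable A \<Longrightarrow> computable (\<lambda>x. A x div 2)"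
proof (rule computable_comp[of "\<lambda>x. x div 2"])
  have "x div 2 = (LEAST y. x < 2 * Suc y)" for x :: nat
    by (rule Least_equality[symmetric]) auto
  moreover have "\<exists>y. x < 2 * Suc y" for x
    by (rule exI[of _ x]) simp
  then have "computable (\<lambda>x. LEAST y. x < 2 * Suc y)"
    by (intro computable_Least computable_intros)
  ultimately show "computable (\<lambda>x. x div 2)" by simp
qed

lemma decidable_even: "computable A \<Longrightarrow> decidable (\<lambda>x. even (A x))"
proof -
  have "even x \<longleftrightarrow> 2 * (x div 2) = x" for x :: nat
    by presburger
  then show "computable A \<Longrightarrow> decidable (\<lambda>x. even (A x))"
    by (simp only:) (intro computable_intros computable_div2)
qed

lemma ce_setI:
  assumes "decidable (\<lambda>z. P (pi1 z) (pi2 z))"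
  shows "ce_set {n. \<exists>t. P n t}"
  unfolding ce_set_def
  by (intro exI conjI, rule partial_computable_search[OF assms, of "\<lambda>_ _. 0"], rule computable_const)
    (auto simp: dom_def)

section \<open>A step-bounded universal relation\<close>

text \<open>The successor keeps 0 free as the code of the empty list.\<close>

definition cons :: "nat \<Rightarrow> nat \<Rightarrow> nat" where
  "cons x l = Suc (pair x l)"

lemma cons_eq_iff [simp]: "cons x l = cons y k \<longleftrightarrow> x = y \<and> l = k" "cons x l \<noteq> 0" "0 \<noteq> cons x l"
  by (simp_all add: cons_def)

lemma computable_cons: "computable A \<Longrightarrow> computable B \<Longrightarrow> computable (\<lambda>x. cons (A x) (B x))"
  unfolding cons_def by (intro computable_intros)

primrec enc_list :: "nat list \<Rightarrow> nat" where
  "enc_list [] = 0"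
| "enc_list (x # xs) = cons x (enc_list xs)"

lemma enc_list_eq_iff [simp]:
  "enc_list xs = 0 \<longleftrightarrow> xs = []"
  "enc_list xs = cons y l \<longleftrightarrow> (\<exists>ys. xs = y # ys \<and> enc_list ys = l)"
  by (cases xs; auto)+

primrec enc :: "recf \<Rightarrow> nat" and encs :: "recf list \<Rightarrow> nat" where
  "enc Zero = pair 0 0"
| "enc Succ = pair 1 0"
| "enc (Proj i) = pair 2 i"
| "enc (Comp e es) = pair 3 (pair (enc e) (encs es))"
| "enc (PRec e d) = pair 4 (pair (enc e) (enc d))"
| "enc (Mu e) = pair 5 (enc e)"
| "encs [] = pair 6 0"
| "encs (e # es) = pair 7 (pair (enc e) (encs es))"

definition judg :: "nat \<Rightarrow> nat \<Rightarrow> nat \<Rightarrow> nat" where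
  "judg c xs y = pair c (pair xs y)"

lemma computable_judg:
  "computable A \<Longrightarrow> computable B \<Longrightarrow> computable C \<Longrightarrow> computable (\<lambda>x. judg (A x) (B x) (C x))"
  unfolding judg_def by (intro computable_intros)

lemma judg_eq_iff [simp]: "judg c xs y = judg c' xs' y' \<longleftrightarrow> c = c' \<and> xs = xs' \<and> y = y'"
  by (simp add: judg_def)

lemma judg_ge: "c \<le> judg c xs y" "xs \<le> judg c xs y" "y \<le> judg c xs y"
  unfolding judg_def by (meson le_pair1 le_pair2 le_trans)+

text \<open>
  \<open>justified S N c xs y\<close> says that the judgement ``program \<open>c\<close> maps \<open>xs\<close> to \<open>y\<close>'' follows
  by one evaluation rule from judgements in \<open>S\<close>. Codes with tags 6 and 7 are lists of programs,
  evaluated to the list of their results. The bound \<open>N\<close> only makes the quantifiers bounded.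
\<close>

definition justified :: "nat set \<Rightarrow> nat \<Rightarrow> nat \<Rightarrow> nat \<Rightarrow> nat \<Rightarrow> bool" where
  "justified S N c xs y \<longleftrightarrow>
     c = pair 0 0 \<and> y = 0 \<or>
     c = pair 1 0 \<and> (\<exists>x<N. xs = cons x 0 \<and> y = Suc x) \<or>
     c = pair 2 0 \<and> (\<exists>l<N. xs = cons y l) \<or>
     (\<exists>i<N. c = pair 2 (Suc i) \<and> (\<exists>x<N. \<exists>l<N. xs = cons x l \<and> judg (pair 2 i) l y \<in> S)) \<or>
     (\<exists>e<N. \<exists>es<N. c = pair 3 (pair e es) \<and> (\<exists>ys<N. judg es xs ys \<in> S \<and> judg e ys y \<in> S)) \<or>
     (\<exists>e<N. \<exists>d<N. c = pair 4 (pair e d) \<and> (\<exists>l<N.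
         xs = cons 0 l \<and> judg e l y \<in> S \<or>
         (\<exists>n<N. \<exists>r<N. xs = cons (Suc n) l \<and> judg c (cons n l) r \<in> S \<and>
            judg d (cons n (cons r l)) y \<in> S))) \<or>
     (\<exists>e<N. c = pair 5 e \<and> judg e (cons y xs) 0 \<in> S \<and>
         (\<forall>m<y. \<exists>r<N. judg e (cons m xs) (Suc r) \<in> S)) \<or>
     c = pair 6 0 \<and> y = 0 \<or>
     (\<exists>e<N. \<exists>es<N. c = pair 7 (pair e es) \<and> (\<exists>v<N. \<exists>l<N. y = cons v l \<and>
         judg e xs v \<in> S \<and> judg es xs l \<in> S))"

text \<open>\<open>S\<close> occurs only positively and \<open>N\<close> only as a bound of
  existential quantifiers; the universal quantifier of the minimisation clause is bounded by
  \<open>y\<close>.\<close>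

lemma justified_mono:
  assumes "justified S N c xs y" "S \<subseteq> T" "N \<le> M"
  shows "justified T M c xs y"
proof -
  have lt: "i < M" if "i < N" for i using that assms(3) by simp
  show ?thesis
    using assms(1) unfolding justified_def
    by (elim disjE exE conjE; simp)
       (blast intro: lt subsetD[OF assms(2)])+
qed

definition closed_judgs :: "nat set \<Rightarrow> nat \<Rightarrow> bool" where
  "closed_judgs S N \<longleftrightarrow> (\<forall>c xs y. judg c xs y \<in> S \<longrightarrow> justified S N c xs y)"

text \<open>Closure does not exclude circular support, and no order of the judgements is recorded.
  Circles are harmless: every rule passes to a subprogram or, for projections and primitive
  recursion, to a smaller index or recursion argument, so induction on the program applies.\<close>

lemma closed_judgs_sound:
  assumes "closed_judgs S N" "judg (enc e) (enc_list xs) y \<in> S"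
  shows "eval e xs = Some y"
  using assms(2)
proof (induction e arbitrary: xs y)
  have J: "justified S N c l v" if "judg c l v \<in> S" for c l v
    using assms(1) that by (simp add: closed_judgs_def)
  {
    case Zero
    then show ?case using J[OF Zero] by (simp add: justified_def)
  next
    case Succ
    then show ?case using J[OF Succ] by (auto simp: justified_def)
  next
    case (Proj i)
    then show ?case
    proof (induction i arbitrary: xs)
      case 0
      then show ?case using J[OF 0] by (auto simp: justified_def)
    next
      case (Suc i)
      obtain x l where "xs = x # l" "judg (pair 2 i) (enc_list l) y \<in> S"
        using J[OF Suc.prems] by (auto simp: justified_def)
      then show ?case using Suc.IH[of l] by (auto split: if_splits)
    qed
  next
    case (Comp e es)
    obtain l where l: "judg (encs es) (enc_list xs) l \<in> S" "judg (enc e) l y \<in> S"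
      using J[OF Comp.prems] by (auto simp: justified_def)
    have "\<exists>ys. l = enc_list ys \<and> those (map (\<lambda>d. eval d xs) es) = Some ys"
      using l(1) Comp.IH(2)
    proof (induction es arbitrary: l)
      case Nil
      then show ?case using J[OF Nil.prems(1)] by (auto simp: justified_def)
    next
      case (Cons d ds)
      obtain v k where "l = cons v k" "judg (enc d) (enc_list xs) v \<in> S"
          "judg (encs ds) (enc_list xs) k \<in> S"
        using J[OF Cons.prems(1)] by (auto simp: justified_def)
      moreover obtain ys where "k = enc_list ys" "those (map (\<lambda>d. eval d xs) ds) = Some ys"
        using Cons.IH[OF calculation(3)] Cons.prems(2) by auto
      ultimately show ?case
        using Cons.prems(2)[of d xs v] by (intro exI[of _ "v # ys"]) simp
    qed
    then show ?case using Comp.IH(1) l(2) by auto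
  next
    case (PRec e d)
    obtain n ys where xs: "xs = n # ys"
      using J[OF PRec.prems] by (auto simp: justified_def)
    have "eval (PRec e d) (n # ys) = Some y" using PRec.prems unfolding xs
    proof (induction n arbitrary: y)
      case 0
      then show ?case using J[OF 0] PRec.IH(1) by (auto simp: justified_def)
    next
      case (Suc n)
      obtain r where "judg (enc (PRec e d)) (enc_list (n # ys)) r \<in> S"
          "judg (enc d) (enc_list (n # r # ys)) y \<in> S"
        using J[OF Suc.prems] by (auto simp: justified_def)
      then show ?case using Suc.IH PRec.IH(2) by fastforce
    qed
    then show ?case using xs by simp
  next
    case (Mu e)
    let ?P = "\<lambda>n. eval e (n # xs) = Some 0"
    have 1: "eval e (y # xs) = Some 0"
      using J[OF Mu.prems] by (intro Mu.IH) (auto simp: justified_def)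
    have 2: "\<exists>r. eval e (m # xs) = Some (Suc r)" if m: "m < y" for m
    proof -
      obtain r where "judg (enc e) (enc_list (m # xs)) (Suc r) \<in> S"
        using J[OF Mu.prems] m by (auto simp: justified_def)
      then show ?thesis using Mu.IH by blast
    qed
    have "(LEAST n. eval e (n # xs) = Some 0) = y"
      by (rule Least_equality[of ?P, OF 1]) (metis 2 linorder_not_less nat.distinct(1) option.inject)
    then show ?case using 1 2 by auto
  }
qed

lemma closed_judgs_Un:
  assumes "closed_judgs S N" "closed_judgs T M"
  shows "closed_judgs (S \<union> T) (max N M)"
  using assms unfolding closed_judgs_def
  by (blast intro: justified_mono[OF _ Un_upper1 max.cobounded1]
      justified_mono[OF _ Un_upper2 max.cobounded2])

lemma closed_judgs_insert:
  assumes "closed_judgs S N" "justified S N c xs y"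
  shows "closed_judgs (insert (judg c xs y) S) N"
  using assms unfolding closed_judgs_def
  by (auto intro: justified_mono[OF _ subset_insertI order_refl])

definition derivable :: "nat \<Rightarrow> nat \<Rightarrow> nat \<Rightarrow> bool" where
  "derivable c xs y \<longleftrightarrow> (\<exists>S N. finite S \<and> closed_judgs S N \<and> judg c xs y \<in> S)"

lemma derivable_common:
  assumes "finite W" "\<forall>c xs y. (c, xs, y) \<in> W \<longrightarrow> derivable c xs y"
  shows "\<exists>S N. finite S \<and> closed_judgs S N \<and> M \<le> N \<and> (\<forall>c xs y. (c, xs, y) \<in> W \<longrightarrow> judg c xs y \<in> S)"
  using assms
proof (induction W rule: finite_induct)
  case empty
  show ?case by (intro exI[of _ "{}"] exI[of _ M]) (simp add: closed_judgs_def)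
next
  case (insert w W)
  have "\<forall>c xs y. (c, xs, y) \<in> W \<longrightarrow> derivable c xs y"
    using insert.prems by simp
  from insert.IH[OF this] obtain S N where S: "finite S" "closed_judgs S N" "M \<le> N"
      "\<forall>c xs y. (c, xs, y) \<in> W \<longrightarrow> judg c xs y \<in> S"
    by (elim exE conjE)
  obtain c xs y where w: "w = (c, xs, y)" by (cases w)
  have "derivable c xs y"
    using insert.prems w by simp
  then obtain T K where T: "finite T" "closed_judgs T K" "judg c xs y \<in> T"
    unfolding derivable_def by (elim exE conjE)
  show ?case
  proof (intro exI conjI)
    show "finite (S \<union> T)" using S T by simp
    show "closed_judgs (S \<union> T) (max N K)" by (rule closed_judgs_Un[OF S(2) T(2)])
    show "M \<le> max N K" using S(3) by simp
    show "\<forall>c xs y. (c, xs, y) \<in> insert w W \<longrightarrow> judg c xs y \<in> S \<union> T"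
      using S(4) T(3) unfolding w by simp
  qed
qed

text \<open>\<open>W\<close> holds the premises of one rule instance. \<open>M\<close> is chosen so
  large, typically one more than a sum, that the bounded quantifiers of \<open>justified\<close>
  reach the witnesses of that instance; the bound of a closed set can always be raised.\<close>

lemma derivableI:
  assumes "finite W" "\<forall>c xs y. (c, xs, y) \<in> W \<longrightarrow> derivable c xs y"
    and "\<And>S N. M \<le> N \<Longrightarrow> \<forall>c xs y. (c, xs, y) \<in> W \<longrightarrow> judg c xs y \<in> S \<Longrightarrow> justified S N c xs y"
  shows "derivable c xs y"
proof -
  obtain S N where S: "finite S" "closed_judgs S N" "M \<le> N"
      "\<forall>c xs y. (c, xs, y) \<in> W \<longrightarrow> judg c xs y \<in> S"
    using derivable_common[OF assms(1,2), where M = M] by (elim exE conjE)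
  have "closed_judgs (insert (judg c xs y) S) N"
    by (rule closed_judgs_insert[OF S(2) assms(3)[OF S(3,4)]])
  then show ?thesis
    unfolding derivable_def using S(1) by (intro exI[of _ "insert (judg c xs y) S"] exI[of _ N]) simp
qed

lemma those_eq_Some_Cons:
  "those (x # xs) = Some ys \<longleftrightarrow> (\<exists>z zs. x = Some z \<and> those xs = Some zs \<and> ys = z # zs)"
  by (auto split: option.splits)

lemma justified_PRec_Suc:
  assumes "judg (pair 4 (pair e d)) (cons n l) r \<in> S" "judg d (cons n (cons r l)) y \<in> S"
    and "e < N" "d < N" "l < N" "n < N" "r < N"
  shows "justified S N (pair 4 (pair e d)) (cons (Suc n) l) y"
  using assms by (simp add: justified_def) blast

lemma derivable_complete: "eval e xs = Some y \<Longrightarrow> derivable (enc e) (enc_list xs) y"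
proof (induction e arbitrary: xs y)
  case Zero
  then show ?case by (intro derivableI[of "{}"]) (auto simp: justified_def)
next
  case Succ
  then obtain x where "xs = [x]" "y = Suc x" by (auto split: list.splits)
  then show ?case by (intro derivableI[of "{}" "Suc x"]) (auto simp: justified_def)
next
  case (Proj i)
  then show ?case
  proof (induction i arbitrary: xs)
    case 0
    then obtain ys where "xs = y # ys" by (cases xs) auto
    then show ?case by (intro derivableI[of "{}" "Suc (enc_list ys)"]) (auto simp: justified_def)
  next
    case (Suc i)
    then obtain x ys where xs: "xs = x # ys" by (cases xs) auto
    then have "derivable (pair 2 i) (enc_list ys) y"
      using Suc by (simp split: if_splits)
    then show ?case
      by (intro derivableI[of "{(pair 2 i, enc_list ys, y)}" "Suc (i + x + enc_list ys)"])
        (auto simp: justified_def xs)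
  qed
next
  case (Comp e es)
  obtain ys where ys: "those (map (\<lambda>d. eval d xs) es) = Some ys" "eval e ys = Some y"
    using Comp.prems by (auto split: option.splits)
  have "derivable (encs es) (enc_list xs) (enc_list ys)"
    using ys(1) Comp.IH(2)
  proof (induction es arbitrary: ys)
    case Nil
    then show ?case by (intro derivableI[of "{}"]) (auto simp: justified_def)
  next
    case (Cons d ds)
    obtain v vs where v: "eval d xs = Some v" "those (map (\<lambda>d. eval d xs) ds) = Some vs" "ys = v # vs"
      using Cons.prems(1) by (auto simp: those_eq_Some_Cons simp del: those.simps)
    then have "derivable (enc d) (enc_list xs) v" "derivable (encs ds) (enc_list xs) (enc_list vs)"
      using Cons by auto
    then show ?case
      by (intro derivableI[of "{(enc d, enc_list xs, v), (encs ds, enc_list xs, enc_list vs)}"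
            "Suc (enc d + encs ds + v + enc_list vs)"])
        (auto simp: justified_def v)
  qed
  moreover have "derivable (enc e) (enc_list ys) y"
    using Comp.IH(1) ys(2) by simp
  ultimately show ?case
    by (intro derivableI[of "{(encs es, enc_list xs, enc_list ys), (enc e, enc_list ys, y)}"
          "Suc (enc e + encs es + enc_list ys)"])
      (auto simp: justified_def intro!: exI[of _ "enc_list ys"])
next
  case (PRec e d)
  then obtain n ys where xs: "xs = n # ys" by (cases xs) auto
  have "derivable (enc (PRec e d)) (enc_list (n # ys)) y" using PRec.prems unfolding xs
  proof (induction n arbitrary: y)
    case 0
    then have "derivable (enc e) (enc_list ys) y" using PRec.IH(1) by simp
    then show ?case
      by (intro derivableI[of "{(enc e, enc_list ys, y)}" "Suc (enc e + enc d + enc_list ys)"])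
        (auto simp: justified_def)
  next
    case (Suc n)
    obtain r where r: "eval (PRec e d) (n # ys) = Some r" "eval d (n # r # ys) = Some y"
      using Suc.prems by (auto split: option.splits)
    have "derivable (enc (PRec e d)) (enc_list (n # ys)) r" "derivable (enc d) (enc_list (n # r # ys)) y"
      using Suc.IH[OF r(1)] PRec.IH(2)[OF r(2)] by auto
    then show ?case
      by (intro derivableI[of "{(enc (PRec e d), enc_list (n # ys), r), (enc d, enc_list (n # r # ys), y)}"
            "Suc (enc e + enc d + enc_list ys + n + r)"])
        (auto intro!: justified_PRec_Suc[where r = r])
  qed
  then show ?case using xs by simp
next
  case (Mu e)
  let ?P = "\<lambda>n. eval e (n # xs) = Some 0"
  obtain n where n: "?P n" "\<forall>m<n. \<exists>r. eval e (m # xs) = Some (Suc r)" and y: "y = (LEAST n. ?P n)"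
    using Mu.prems by (auto split: if_splits)
  have "y = n"
    unfolding y
    by (rule Least_equality[of ?P, OF n(1)]) (metis n(2) linorder_not_less nat.distinct(1) option.inject)
  then obtain R where R: "\<And>m. m < y \<Longrightarrow> eval e (m # xs) = Some (Suc (R m))"
    using n(2) by metis
  \<comment> \<open>The premises of the minimisation rule: value 0 at \<open>y\<close> and successor
    values at the finitely many smaller arguments.\<close>
  define W where "W = insert (enc e, cons y (enc_list xs), 0)
    ((\<lambda>m. (enc e, cons m (enc_list xs), Suc (R m))) ` {..<y})"
  have "derivable c l v" if "(c, l, v) \<in> W" for c l v
    using that Mu.IH[of "y # xs" 0] Mu.IH[of "m # xs" "Suc (R m)" for m] n(1) R \<open>y = n\<close>
    by (auto simp: W_def)
  moreover have "justified S N (enc (Mu e)) (enc_list xs) y"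
    if "Suc (enc e + sum R {..<y}) \<le> N" "\<forall>c xs y. (c, xs, y) \<in> W \<longrightarrow> judg c xs y \<in> S" for S N
  proof -
    have "R m < N" if "m < y" for m
      using member_le_sum[of m "{..<y}" R] that \<open>Suc (enc e + sum R {..<y}) \<le> N\<close> by simp
    moreover have "enc e < N" "judg (enc e) (cons y (enc_list xs)) 0 \<in> S"
      "\<And>m. m < y \<Longrightarrow> judg (enc e) (cons m (enc_list xs)) (Suc (R m)) \<in> S"
      using that by (auto simp: W_def)
    ultimately show ?thesis by (auto simp: justified_def)
  qed
  ultimately show ?case
    by (intro derivableI[of W "Suc (enc e + sum R {..<y})"]) (auto simp: W_def)
qed

lemma decidable_set_decode:
  assumes "computable A" "computable B"
  shows "decidable (\<lambda>x. A x \<in> set_decode (B x))"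
proof -
  have "rec_nat z (\<lambda>m r. r div 2) n = z div 2 ^ n" for z n :: nat
    by (induction n) (simp_all add: div_mult2_eq power_Suc2 del: power_Suc)
  then have "n \<in> set_decode z \<longleftrightarrow> \<not> even (rec_nat z (\<lambda>m r. r div 2) n)" for z n
    by (simp add: set_decode_def)
  moreover have "decidable (\<lambda>x. \<not> even (rec_nat (B x) (\<lambda>m r. r div 2) (A x)))"
    by (intro decidable_not decidable_even computable_rec_nat computable_div2 computable_intros assms)
  ultimately show ?thesis by simp
qed

lemma less_of_mem_set_decode: "n \<in> set_decode z \<Longrightarrow> n < z"
proof -
  assume "n \<in> set_decode z"
  then have "z div 2 ^ n \<noteq> 0" by (auto simp: set_decode_def elim!: oddE)
  then have "2 ^ n \<le> z" by (metis div_less not_le)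
  then show "n < z" using less_exp[of n] by (rule order.strict_trans2[rotated])
qed

lemma decidable_justified:
  assumes "computable Z" "computable N" "computable A" "computable B" "computable C"
  shows "decidable (\<lambda>x. justified (set_decode (Z x)) (N x) (A x) (B x) (C x))"
  unfolding justified_def
  by (intro decidable_set_decode computable_judg computable_cons computable_intros
      assms assms[THEN computable_comp])

text \<open>The witness \<open>w\<close> codes the claimed value, a finite set of judgements in
  binary and the quantifier bound, nested as \<open>pair y (pair z N)\<close>.\<close>

definition halts_by :: "nat \<Rightarrow> nat \<Rightarrow> nat \<Rightarrow> bool" where
  "halts_by e n w \<longleftrightarrow> judg e (cons n 0) (pi1 w) \<in> set_decode (pi1 (pi2 w)) \<and>
     closed_judgs (set_decode (pi1 (pi2 w))) (pi2 (pi2 w))"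

text \<open>
  Insisting on the least witness makes the relation single-valued also for numbers \<open>e\<close>
  that code no program.
\<close>

definition run :: "nat \<Rightarrow> nat \<Rightarrow> nat \<Rightarrow> nat \<Rightarrow> bool" where
  "run e n y t \<longleftrightarrow> n < t \<and> (\<exists>w<t. pi1 w = y \<and> halts_by e n w \<and> (\<forall>w'<w. \<not> halts_by e n w'))"

text \<open>A member of \<open>set_decode z\<close> is below \<open>z\<close>, and pairing dominates
  its components, so the quantifiers become bounded. This is what makes \<open>run\<close>
  decidable.\<close>

lemma closed_judgs_set_decode:
  "closed_judgs (set_decode z) N \<longleftrightarrow> (\<forall>c<z. \<forall>xs<z. \<forall>y<z.
     judg c xs y \<in> set_decode z \<longrightarrow> justified (set_decode z) N c xs y)"
proof -
  have "c < z \<and> xs < z \<and> y < z" if "judg c xs y \<in> set_decode z" for c xs y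
    using less_of_mem_set_decode[OF that] judg_ge[of c xs y] judg_ge[of xs c y] by (meson le_less_trans judg_ge)
  then show ?thesis unfolding closed_judgs_def by blast
qed

lemma decidable_run:
  assumes "computable A" "computable B" "computable C" "computable T"
  shows "decidable (\<lambda>x. run (A x) (B x) (C x) (T x))"
  unfolding run_def halts_by_def closed_judgs_set_decode
  by (intro decidable_set_decode computable_judg computable_cons decidable_justified computable_intros
      assms assms[THEN computable_comp])

lemma run_mono: "run e n y t \<Longrightarrow> t \<le> t' \<Longrightarrow> run e n y t'"
  unfolding run_def by (elim conjE exE, intro conjI) (simp, metis less_le_trans)

lemma run_fun: "run e n y t \<Longrightarrow> run e n y' t' \<Longrightarrow> y = y'"
  unfolding run_def by (metis linorder_neqE_nat)

text \<open>The value is a component of the witness below \<open>t\<close>. Thus quantifiers over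
  values may be cut off at the stage, and convergence at large arguments is seen only at late
  stages.\<close>

lemma run_bound: "run e n y t \<Longrightarrow> n < t" "run e n y t \<Longrightarrow> y < t"
  unfolding run_def by (auto intro: le_less_trans[OF le_pair1[of "pi1 w" "pi2 w" for w, simplified]])

text \<open>Enumeration theorem. The diagonalisations know a program only through the index obtained
  here, while the sets are built from \<open>run\<close> for arbitrary numbers
  \<open>e\<close>.\<close>

lemma run_index:
  assumes "partial_computable f"
  obtains e where "\<And>n y. f n = Some y \<longleftrightarrow> (\<exists>t. run e n y t)"
proof -
  obtain r where r: "\<And>n. eval r [n] = f n"
    using assms by (auto simp: partial_computable_def)
  have sound: "f n = Some (pi1 w)" if "halts_by (enc r) n w" for n w
    using that closed_judgs_sound[of _ _ r "[n]"] by (auto simp: halts_by_def r)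
  have "\<exists>t. run (enc r) n y t" if fn: "f n = Some y" for n y
  proof -
    obtain S N where S: "finite S" "closed_judgs S N" "judg (enc r) (cons n 0) y \<in> S"
      using derivable_complete[of r "[n]" y] fn by (auto simp: r derivable_def)
    then have "halts_by (enc r) n (pair y (pair (set_encode S) N))"
      by (simp add: halts_by_def)
    then obtain w where w: "halts_by (enc r) n w" "\<forall>w'<w. \<not> halts_by (enc r) n w'"
      by (metis exists_least_iff)
    \<comment> \<open>The least witness may differ from the one constructed above; soundness gives
      it the same value.\<close>
    then have "pi1 w = y" using sound[OF w(1)] fn by simp
    then show ?thesis using w unfolding run_def by (intro exI[of _ "Suc (max n w)"] conjI exI[of _ w]) auto
  qed
  moreover have "f n = Some y" if "run (enc r) n y t" for n y t
    using that sound by (auto simp: run_def)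
  ultimately show ?thesis using that by blast
qed

section \<open>Small sets and the six properties\<close>

text \<open>Up to an arbitrarily small change of \<epsilon>, this is upper density at most
  \<epsilon>. Descriptions are measured by their error sets because such bounds add under
  unions.\<close>

definition small :: "real \<Rightarrow> nat set \<Rightarrow> bool" where
  "small \<epsilon> B \<longleftrightarrow> (\<forall>\<^sub>F n in sequentially. real (card (B \<inter> {0..<n})) \<le> \<epsilon> * real n)"

definition null :: "nat set \<Rightarrow> bool" where
  "null B \<longleftrightarrow> (\<forall>\<epsilon>>0. small \<epsilon> B)"

lemma small_subset: "small \<epsilon> B \<Longrightarrow> A \<subseteq> B \<Longrightarrow> small \<epsilon> A"
  unfolding small_def
  by (erule eventually_mono) (meson card_mono finite_Int finite_atLeastLessThan Int_mono order_refl
      of_nat_le_iff order_trans)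

lemma small_mono: "small \<epsilon> B \<Longrightarrow> \<epsilon> \<le> \<delta> \<Longrightarrow> small \<delta> B"
  unfolding small_def by (erule eventually_mono) (meson mult_right_mono of_nat_0_le_iff order_trans)

lemma small_Un:
  assumes "small \<epsilon> A" "small \<delta> B"
  shows "small (\<epsilon> + \<delta>) (A \<union> B)"
  using assms unfolding small_def
proof eventually_elim
  case (elim n)
  have "card ((A \<union> B) \<inter> {0..<n}) \<le> card (A \<inter> {0..<n}) + card (B \<inter> {0..<n})"
    by (metis Int_Un_distrib2 card_Un_le)
  then show ?case using elim by (simp add: distrib_right)
qed

lemma null_subset: "null B \<Longrightarrow> A \<subseteq> B \<Longrightarrow> null A"
  unfolding null_def using small_subset by blast

lemma null_Un: "null A \<Longrightarrow> null B \<Longrightarrow> null (A \<union> B)"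
  unfolding null_def using small_Un[of "\<epsilon> / 2" A "\<epsilon> / 2" B for \<epsilon>] by (metis field_sum_of_halves half_gt_zero)

text \<open>For large \<open>n\<close> the additive constant is absorbed by the gap between
  \<epsilon> and \<delta>.\<close>

lemma smallI:
  assumes "\<And>n. real (card (B \<inter> {0..<n})) \<le> \<epsilon> * real n + c" "\<epsilon> < \<delta>"
  shows "small \<delta> B"
  unfolding small_def
proof (rule eventually_mono[OF eventually_ge_at_top[of "nat \<lceil>c / (\<delta> - \<epsilon>)\<rceil>"]])
  fix n assume "nat \<lceil>c / (\<delta> - \<epsilon>)\<rceil> \<le> n"
  then have "c / (\<delta> - \<epsilon>) \<le> real n" by linarith
  then have "c \<le> (\<delta> - \<epsilon>) * real n" using assms(2) by (simp add: field_simps)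
  then show "real (card (B \<inter> {0..<n})) \<le> \<delta> * real n"
    using assms(1)[of n] by (simp add: algebra_simps)
qed

lemma null_finite: "finite B \<Longrightarrow> null B"
  unfolding null_def
  by (intro allI impI smallI[of B 0 "real (card B)"]) (auto intro!: card_mono)

lemma rho_compl: "0 < n \<Longrightarrow> rho n A = 1 - real (card ((- A) \<inter> {0..<n})) / real n"
proof -
  assume n: "0 < n"
  have "card (A \<inter> {0..<n} \<union> (- A) \<inter> {0..<n}) = card (A \<inter> {0..<n}) + card ((- A) \<inter> {0..<n})"
    by (intro card_Un_disjoint) auto
  moreover have "A \<inter> {0..<n} \<union> (- A) \<inter> {0..<n} = {0..<n}"
    by auto
  ultimately have "real (card (A \<inter> {0..<n})) + real (card ((- A) \<inter> {0..<n})) = real n"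
    by (simp flip: of_nat_add)
  then show ?thesis using n unfolding rho_def by (simp add: field_simps)
qed

lemma rho_bounds: "0 \<le> rho n A" "rho n A \<le> 1"
proof -
  have "card (A \<inter> {0..<n}) \<le> card {0..<n}" by (rule card_mono) auto
  then show "rho n A \<le> 1" unfolding rho_def by (auto simp: divide_le_eq_1)
qed (simp add: rho_def)

lemma small_iff_rho: "small \<epsilon> (- A) \<longleftrightarrow> (\<forall>\<^sub>F n in sequentially. 1 - \<epsilon> \<le> rho n A)"
proof -
  have "real (card ((- A) \<inter> {0..<n})) \<le> \<epsilon> * real n \<longleftrightarrow> 1 - \<epsilon> \<le> rho n A" if "0 < n" for n
    unfolding rho_compl[OF that] using that by (simp add: field_simps)
  then have "\<forall>\<^sub>F n in sequentially. real (card ((- A) \<inter> {0..<n})) \<le> \<epsilon> * real n \<longleftrightarrow> 1 - \<epsilon> \<le> rho n A"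
    by (intro eventually_mono[OF eventually_gt_at_top[of 0]])
  then show ?thesis unfolding small_def by (rule eventually_subst)
qed

lemma lower_density_ge: "small \<epsilon> (- A) \<Longrightarrow> ereal (1 - \<epsilon>) \<le> lower_density A"
  unfolding lower_density_def small_iff_rho by (intro Liminf_bounded) simp

text \<open>The strict inequality gives room: a sequence with limit inferior \<open>r\<close> may
  stay below \<open>r\<close> throughout.\<close>

lemma small_of_lower_density: "ereal r \<le> lower_density A \<Longrightarrow> 1 - r < \<epsilon> \<Longrightarrow> small \<epsilon> (- A)"
proof -
  assume "ereal r \<le> lower_density A" "1 - r < \<epsilon>"
  then have "ereal (1 - \<epsilon>) < lower_density A"
    by (rule_tac less_le_trans[of _ "ereal r"]) auto
  then show ?thesis
    unfolding lower_density_def small_iff_rho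
    by (rule eventually_mono[OF less_LiminfD]) simp
qed

lemma lower_density_le_1: "lower_density A \<le> 1"
  unfolding lower_density_def
  by (rule order_trans[OF Liminf_le_Limsup Limsup_bounded]) (auto simp: rho_bounds)

lemma has_density_1_iff: "has_density A 1 \<longleftrightarrow> null (- A)"
proof
  assume "has_density A 1"
  then show "null (- A)"
    unfolding null_def has_density_def by (auto intro: small_of_lower_density[of 1])
next
  assume *: "null (- A)"
  have "ereal r \<le> lower_density A" if "r < 1" for r
    using lower_density_ge[of "1 - r" A] * that by (auto simp: null_def)
  then have "1 \<le> lower_density A"
    using ereal_dense2[of "lower_density A" 1] by (force simp: not_le[symmetric])
  moreover have "lower_density A \<le> upper_density A"
    unfolding lower_density_def upper_density_def by (rule Liminf_le_Limsup) simp
  moreover have "upper_density A \<le> 1"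
    unfolding upper_density_def by (rule Limsup_bounded) (auto simp: rho_bounds)
  ultimately show "has_density A 1"
    unfolding has_density_def one_ereal_def[symmetric] by (metis order_trans order_antisym)
qed

text \<open>The common form of \<alpha> and \<gamma>, with \<open>A f\<close> the set on which
  \<open>f\<close> succeeds. The function \<open>f\<^sub>0\<close> contributes the element 0, so
  that the real \<open>Sup\<close> is taken of a nonempty set.\<close>

lemma Sup_lower_density_eq_1_iff:
  assumes "X f\<^sub>0"
  shows "Sup {r. \<exists>f. X f \<and> ereal r \<le> lower_density (A f)} = 1 \<longleftrightarrow>
    (\<forall>\<epsilon>>0. \<exists>f. X f \<and> small \<epsilon> (- A f))" (is "Sup ?S = 1 \<longleftrightarrow> ?R")
proof -
  have le: "r \<le> 1" if r: "r \<in> ?S" for r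
  proof -
    obtain f where "ereal r \<le> lower_density (A f)" using r by blast
    also have "\<dots> \<le> 1" by (rule lower_density_le_1)
    finally show ?thesis by simp
  qed
  have bdd: "bdd_above ?S" using le by (rule bdd_aboveI)
  have "ereal 0 \<le> lower_density (A f\<^sub>0)"
    unfolding lower_density_def by (intro Liminf_bounded) (auto simp: rho_bounds)
  then have ne: "?S \<noteq> {}" using assms by auto
  show ?thesis
  proof
    assume S: "Sup ?S = 1"
    show ?R
    proof (intro allI impI)
      fix \<epsilon> :: real assume "0 < \<epsilon>"
      then obtain r where "r \<in> ?S" "1 - \<epsilon> < r"
        using less_cSupD[OF ne, of "1 - \<epsilon>"] S by auto
      then obtain f where "X f" "ereal r \<le> lower_density (A f)" "1 - r < \<epsilon>"
        by auto
      then show "\<exists>f. X f \<and> small \<epsilon> (- A f)"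
        using small_of_lower_density by blast
    qed
  next
    assume R: ?R
    have "1 \<le> Sup ?S + \<epsilon>" if \<epsilon>: "\<epsilon> > 0" for \<epsilon>
    proof -
      obtain f where "X f" "small \<epsilon> (- A f)" using R \<epsilon> by blast
      then have "1 - \<epsilon> \<in> ?S" using lower_density_ge by auto
      then have "1 - \<epsilon> \<le> Sup ?S" using bdd by (rule cSup_upper)
      then show ?thesis by linarith
    qed
    then have "1 \<le> Sup ?S" by (rule field_le_epsilon)
    moreover have "Sup ?S \<le> 1" using ne le by (rule cSup_least)
    ultimately show "Sup ?S = 1" by simp
  qed
qed

section \<open>Branching between partial functions\<close>

lemma partial_computable_Some: "computable f \<Longrightarrow> partial_computable (\<lambda>n. Some (f n))"
  by (simp add: computable_def)

text \<open>Strict composition would evaluate both branches and inherit undefinedness from the wrong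
  one. The search instead runs over coded pairs of value and stage for the selected branch only; as
  \<open>run\<close> is single-valued, any witness yields the right value.\<close>

lemma partial_computable_if:
  assumes "decidable P" "partial_computable f" "computable A" "partial_computable g" "computable B"
  shows "partial_computable (\<lambda>n. if P n then f (A n) else g (B n))"
proof -
  obtain d where d: "\<And>n y. f n = Some y \<longleftrightarrow> (\<exists>t. run d n y t)"
    using run_index[OF assms(2)] by blast
  obtain e where e: "\<And>n y. g n = Some y \<longleftrightarrow> (\<exists>t. run e n y t)"
    using run_index[OF assms(4)] by blast
  define R where "R n w \<longleftrightarrow> (if P n then run d (A n) (pi1 w) (pi2 w) else run e (B n) (pi1 w) (pi2 w))" for n w
  let ?h = "\<lambda>n. if P n then f (A n) else g (B n)"
  have R: "?h n = Some y \<longleftrightarrow> (\<exists>t. R n (pair y t))" for n y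
    by (simp add: R_def d e)
  have "decidable (\<lambda>z. R (pi1 z) (pi2 z))"
    unfolding R_def
    by (intro computable_intros decidable_run decidable_comp[OF assms(1)]
        computable_comp[OF assms(3)] computable_comp[OF assms(5)])
  then have pc: "partial_computable (\<lambda>n. if \<exists>w. R n w then Some (pi1 (LEAST w. R n w)) else None)"
    by (rule partial_computable_search) (intro computable_intros)
  have "?h n = (if \<exists>w. R n w then Some (pi1 (LEAST w. R n w)) else None)" for n
  proof (cases "\<exists>w. R n w")
    case True
    then have "R n (LEAST w. R n w)" by (rule LeastI_ex)
    then have "?h n = Some (pi1 (LEAST w. R n w))" unfolding R by (metis pair_pi)
    then show ?thesis using True by simp
  next
    case False
    then have "?h n \<noteq> Some y" for y unfolding R by blast
    then have "?h n = None" by blast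
    then show ?thesis using False by simp
  qed
  then have "?h = (\<lambda>n. if \<exists>w. R n w then Some (pi1 (LEAST w. R n w)) else None)" by (rule ext)
  then show ?thesis using pc by simp
qed

lemma partial_computable_None: "partial_computable (\<lambda>n. None)"
  using partial_computable_search[OF decidable_const[of False] computable_const] by simp

lemma partial_computable_guard:
  "decidable P \<Longrightarrow> computable f \<Longrightarrow> partial_computable (\<lambda>n. if P n then Some (f n) else None)"
  by (rule partial_computable_if[of P "\<lambda>n. Some (f n)" "\<lambda>n. n" "\<lambda>n. None" "\<lambda>n. n"])
    (simp_all add: partial_computable_Some partial_computable_None computable_id)

lemma partial_computable_comp:
  "partial_computable f \<Longrightarrow> computable A \<Longrightarrow> partial_computable (\<lambda>n. f (A n))"
  using partial_computable_if[OF decidable_const[of True], of f A f A] by simp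

section \<open>The six properties in terms of error sets\<close>

lemma EDC_iff: "satisfies g EDC \<longleftrightarrow>
  (\<exists>h. computable h \<and> (\<forall>n. h n = 0 \<or> h n = Suc (g n)) \<and> null {n. h n = 0})"
proof -
  have sd: "- strong_domain f = {n. box_code (f n) = 0}" for f
  proof -
    have "f n \<in> range Val \<longleftrightarrow> box_code (f n) \<noteq> 0" for n
      by (cases "f n") auto
    then show ?thesis by (auto simp: strong_domain_def)
  qed
  have sp: "strong_partial_description f g \<longleftrightarrow> (\<forall>n. box_code (f n) = 0 \<or> box_code (f n) = Suc (g n))" for f
  proof -
    have "(f n \<noteq> Box \<longrightarrow> f n = Val (g n)) \<longleftrightarrow> box_code (f n) = 0 \<or> box_code (f n) = Suc (g n)" for n
      by (cases "f n") auto
    then show ?thesis by (simp add: strong_partial_description_def)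
  qed
  have surj: "\<exists>f. h = (\<lambda>n. box_code (f n))" for h
  proof
    show "h = (\<lambda>n. box_code (case h n of 0 \<Rightarrow> Box | Suc k \<Rightarrow> Val k))"
      by (auto split: nat.splits)
  qed
  show ?thesis
    unfolding satisfies.simps effectively_densely_computable_def effective_dense_description_def
      computable_box_def has_density_1_iff sd sp
  proof (intro iffI; elim exE conjE)
    fix h assume h: "computable h" "\<forall>n. h n = 0 \<or> h n = Suc (g n)" "null {n. h n = 0}"
    obtain f where f: "h = (\<lambda>n. box_code (f n))" using surj by blast
    show "\<exists>f. computable (\<lambda>n. box_code (f n)) \<and>
        (\<forall>n. box_code (f n) = 0 \<or> box_code (f n) = Suc (g n)) \<and> null {n. box_code (f n) = 0}"
      using h unfolding f by (intro exI conjI)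
  qed (intro exI conjI)
qed

lemma CC_iff: "satisfies g CC \<longleftrightarrow> (\<exists>h. computable h \<and> null {n. h n \<noteq> g n})"
  by (simp add: coarsely_computable_def coarse_description_def has_density_1_iff Collect_neg_eq)

lemma partial_description_iff: "partial_description f g \<longleftrightarrow> (\<forall>n. f n = None \<or> f n = Some (g n))"
  unfolding partial_description_def by (metis domD domIff option.distinct(1))

lemma minus_dom: "- dom f = {n. f n = None}"
  by (auto simp: dom_def)

lemma GC_iff: "satisfies g GC \<longleftrightarrow>
  (\<exists>f. partial_computable f \<and> (\<forall>n. f n = None \<or> f n = Some (g n)) \<and> null {n. f n = None})"
  by (simp add: generically_computable_def generic_description_def has_density_1_iff
      partial_description_iff minus_dom)

lemma DC_iff: "satisfies g DC \<longleftrightarrow> (\<exists>f. partial_computable f \<and> null {n. f n \<noteq> Some (g n)})"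
  by (simp add: densely_computable_def dense_description_def has_density_1_iff Collect_neg_eq)

lemma Alpha1_iff: "satisfies g Alpha1 \<longleftrightarrow>
  (\<forall>\<epsilon>>0. \<exists>f. partial_computable f \<and> (\<forall>n. f n = None \<or> f n = Some (g n)) \<and> small \<epsilon> {n. f n = None})"
  using Sup_lower_density_eq_1_iff[of "\<lambda>f. partial_computable f \<and> partial_description f g" "\<lambda>n. None" dom]
  by (simp add: alpha_def partial_computable_None partial_description_iff minus_dom conj_assoc)

lemma Gamma1_iff: "satisfies g Gamma1 \<longleftrightarrow> (\<forall>\<epsilon>>0. \<exists>h. computable h \<and> small \<epsilon> {n. h n \<noteq> g n})"
  using Sup_lower_density_eq_1_iff[of computable "\<lambda>n. 0" "\<lambda>h. {n. h n = g n}"]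
  by (simp add: gamma_def computable_const Collect_neg_eq)

section \<open>Columns, blocks and the implications\<close>

text \<open>The exponent of \<open>2\<close> in \<open>n\<close>; note \<open>col 0 = 0\<close>.\<close>

definition col :: "nat \<Rightarrow> nat" where
  "col n = (LEAST k. n = 0 \<or> (\<exists>q<n. n = 2 ^ k * (2 * q + 1)))"

text \<open>The integer part of the binary logarithm for positive \<open>n\<close>, and 0 at 0.
  Hence \<open>block s\<close> consists of the positive numbers with
  \<open>lg n = s\<close>.\<close>

definition lg :: "nat \<Rightarrow> nat" where
  "lg n = (LEAST s. n < 2 ^ Suc s)"

lemma col_exists: "\<exists>k q. n = 0 \<or> n = 2 ^ k * (2 * q + 1)" for n :: nat
proof (induction n rule: less_induct)
  case (less n)
  show ?case
  proof (cases "even n \<and> n \<noteq> 0")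
    case True
    then obtain m where m: "n = 2 * m" "m < n" "m \<noteq> 0" by (auto elim!: evenE)
    then obtain k q where "m = 2 ^ k * (2 * q + 1)" using less[of m] by auto
    then have "n = 2 ^ Suc k * (2 * q + 1)" by (simp add: m)
    then show ?thesis by blast
  next
    case False
    then have "n = 0 \<or> n = 2 ^ 0 * (2 * (n div 2) + 1)" by auto
    then show ?thesis by blast
  qed
qed

text \<open>Justifies the bound \<open>q<n\<close> in \<open>col\<close>, which keeps the predicate
  searched there decidable.\<close>

lemma odd_part_le: "q < 2 ^ k * (2 * q + 1)" for q :: nat
proof -
  have "q < 1 * (2 * q + 1)" by simp
  also have "\<dots> \<le> 2 ^ k * (2 * q + 1)" by (rule mult_le_mono1) simp
  finally show ?thesis .
qed

lemma col_unique:
  fixes q r :: nat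
  assumes "2 ^ k * (2 * q + 1) = 2 ^ j * (2 * r + 1)"
  shows "k = j"
proof -
  have "j \<le> k" if "2 ^ k * (2 * q + 1) = 2 ^ j * (2 * r + 1)" for k j q r :: nat
  proof (rule ccontr)
    assume "\<not> j \<le> k"
    then obtain d where d: "j = k + Suc d" by (metis add_Suc_right less_iff_Suc_add not_le)
    have "2 ^ k * (2 * q + 1) = 2 ^ k * (2 * (2 ^ d * (2 * r + 1)))"
      using that by (simp add: d power_add algebra_simps)
    then have "2 * q + 1 = 2 * (2 ^ d * (2 * r + 1))" by (subst (asm) mult_left_cancel) simp_all
    then show False by presburger
  qed
  from this[OF assms] this[OF assms[symmetric]] show ?thesis by simp
qed

lemma col_eq [simp]: "col (2 ^ k * (2 * q + 1)) = k"
  unfolding col_def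
proof (rule Least_equality)
  show "2 ^ k * (2 * q + 1) = 0 \<or> (\<exists>r<2 ^ k * (2 * q + 1). 2 ^ k * (2 * q + 1) = 2 ^ k * (2 * r + 1))"
    using odd_part_le by blast
  show "k \<le> j" if "2 ^ k * (2 * q + 1) = 0 \<or> (\<exists>r<2 ^ k * (2 * q + 1). 2 ^ k * (2 * q + 1) = 2 ^ j * (2 * r + 1))" for j
    using that col_unique[of k q j] by (auto simp del: mult_Suc_right)
qed

lemma col_0 [simp]: "col 0 = 0"
  by (simp add: col_def)

lemma col_decomp: "0 < n \<Longrightarrow> \<exists>q. n = 2 ^ col n * (2 * q + 1)"
  using col_exists[of n] col_eq by (metis less_numeral_extra(3))

lemma power_col_dvd: "2 ^ col n dvd n"
  using col_decomp[of n] by (cases "n = 0") (simp, metis dvd_triv_left gr0I)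

lemma col_le: "col n \<le> n"
proof (cases "n = 0")
  case False
  then have "2 ^ col n \<le> n" using power_col_dvd dvd_imp_le by blast
  then show ?thesis using less_exp[of "col n"] by linarith
qed simp

lemma computable_col: "computable A \<Longrightarrow> computable (\<lambda>x. col (A x))"
proof (rule computable_comp[of col])
  have "\<exists>k. n = 0 \<or> (\<exists>q<n. n = 2 ^ k * (2 * q + 1))" for n :: nat
    using col_exists[of n] odd_part_le by blast
  then show "computable col"
    unfolding col_def by (intro computable_Least computable_intros)
qed

lemma lg_less: "n < 2 ^ Suc (lg n)"
  unfolding lg_def by (rule LeastI[of _ n], rule less_le_trans[OF less_exp]) simp

lemma lg_eqI: "2 ^ s \<le> n \<Longrightarrow> n < 2 ^ Suc s \<Longrightarrow> lg n = s"
  unfolding lg_def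
proof (rule Least_equality)
  show "s \<le> t" if "2 ^ s \<le> n" "n < 2 ^ Suc t" for t
  proof -
    have "(2::nat) ^ s < 2 ^ Suc t" using that by linarith
    then show ?thesis by (simp add: power_strict_increasing_iff del: power_Suc)
  qed
qed

lemma lg_le: "0 < n \<Longrightarrow> 2 ^ lg n \<le> n"
proof (cases "lg n")
  case (Suc s)
  have "\<not> n < 2 ^ Suc s" unfolding lg_def using Suc not_less_Least[of s "\<lambda>s. n < 2 ^ Suc s"] by (simp add: lg_def)
  then show ?thesis by (simp add: Suc)
qed simp

lemma computable_lg: "computable A \<Longrightarrow> computable (\<lambda>x. lg (A x))"
proof (rule computable_comp[of lg])
  have "\<exists>s. n < 2 ^ Suc s" for n :: nat
    using lg_less by blast
  then show "computable lg"
    unfolding lg_def by (intro computable_Least computable_intros)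
qed

section \<open>Dyadic blocks and their cells\<close>

definition block :: "nat \<Rightarrow> nat set" where
  "block s = {2 ^ s..<2 ^ Suc s}"

definition cell :: "nat \<Rightarrow> nat \<Rightarrow> nat set" where
  "cell e s = {n \<in> block s. col n = e}"

lemma lg_block: "n \<in> block s \<Longrightarrow> lg n = s"
  by (simp add: block_def lg_eqI)

lemma finite_block [simp]: "finite (block s)" and finite_cell [simp]: "finite (cell e s)"
  by (simp_all add: block_def cell_def)

lemma card_block: "card (block s) = 2 ^ s"
  by (simp add: block_def)

text \<open>Column \<open>e\<close> takes the share \<open>2 ^ -(e+1)\<close> of block
  \<open>e + d + 1\<close>, namely the odd multiples \<open>2 ^ e * (2 * i + 1)\<close> with
  \<open>i\<close> in block \<open>d\<close>.\<close>

lemma card_cell: "2 ^ d \<le> card (cell e (Suc (e + d)))"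
proof -
  let ?f = "\<lambda>i::nat. 2 ^ e * (2 * i + 1)"
  have "?f ` {2 ^ d..<2 ^ Suc d} \<subseteq> cell e (Suc (e + d))"
  proof safe
    fix i :: nat assume i: "i \<in> {2 ^ d..<2 ^ Suc d}"
    have "2 ^ e * (2 * 2 ^ d) \<le> ?f i" using i by (intro mult_le_mono2) auto
    moreover have "?f i < 2 ^ e * (2 * 2 ^ Suc d)" using i by (intro mult_strict_left_mono) auto
    ultimately have "?f i \<in> block (Suc (e + d))"
      by (simp add: block_def power_add algebra_simps)
    then show "?f i \<in> cell e (Suc (e + d))" unfolding cell_def mem_Collect_eq by (intro conjI col_eq)
  qed
  moreover have "inj_on ?f {2 ^ d..<2 ^ Suc d}" by (auto intro: inj_onI)
  ultimately have "card {2 ^ d..<2 ^ Suc d :: nat} \<le> card (cell e (Suc (e + d)))"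
    by (metis card_inj_on_le finite_cell)
  then show ?thesis by simp
qed

text \<open>The factor 2 arises because block \<open>s\<close> has length \<open>2 ^ s\<close> but
  is compared with the initial segment of length \<open>2 ^ (s + 1)\<close>.\<close>

lemma small_block:
  assumes "small \<epsilon> B"
  shows "\<forall>\<^sub>F s in sequentially. real (card (B \<inter> block s)) \<le> 2 * \<epsilon> * 2 ^ s"
proof -
  obtain N where N: "\<And>n. N \<le> n \<Longrightarrow> real (card (B \<inter> {0..<n})) \<le> \<epsilon> * real n"
    using assms by (auto simp: small_def eventually_sequentially)
  have "real (card (B \<inter> block s)) \<le> 2 * \<epsilon> * 2 ^ s" if "N \<le> s" for s
  proof -
    have "s < 2 ^ Suc s" by (rule less_le_trans[OF less_exp]) simp
    then have "real (card (B \<inter> {0..<2 ^ Suc s})) \<le> \<epsilon> * real (2 ^ Suc s)"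
      using that by (intro N) simp
    moreover have "card (B \<inter> block s) \<le> card (B \<inter> {0..<2 ^ Suc s})"
      by (intro card_mono) (auto simp: block_def)
    ultimately show ?thesis by simp
  qed
  then show ?thesis by (auto simp: eventually_sequentially)
qed

text \<open>The means of refuting density 1: since column \<open>e\<close> has positive density, a
  null set eventually covers less than half of each of its cells. A diagonalisation need only spoil
  half a cell infinitely often.\<close>

lemma null_cell:
  assumes "null B"
  shows "\<forall>\<^sub>F s in sequentially. 2 * card (B \<inter> cell e s) < card (cell e s)"
proof -
  \<comment> \<open>The share \<open>2 ^ -(e+1)\<close> of the column is divided by 8: a factor 2
    for passing to a block, one for the doubled cardinality and one for strictness.\<close>
  have "small (1 / 2 ^ (e + 4)) B" using assms by (simp add: null_def)
  from small_block[OF this] eventually_gt_at_top[of e] show ?thesis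
  proof eventually_elim
    case (elim s)
    then obtain d where s: "s = Suc (e + d)" by (metis less_iff_Suc_add)
    have "card (B \<inter> cell e s) \<le> card (B \<inter> block s)"
      by (intro card_mono) (auto simp: cell_def)
    then have "2 * real (card (B \<inter> cell e s)) \<le> 4 * (1 / 2 ^ (e + 4)) * 2 ^ s"
      using elim(1) by simp
    also have "\<dots> = 2 ^ d / 2" by (simp add: s power_add field_simps)
    also have "\<dots> < 2 ^ d" by simp
    also have "\<dots> \<le> real (card (cell e s))" using card_cell[of d e] by (simp add: s flip: of_nat_le_iff)
    finally show ?case by linarith
  qed
qed

text \<open>All these numbers are multiples of \<open>2 ^ k\<close>. The bound holds for the whole
  tail of columns at once.\<close>

lemma small_columns:
  assumes "1 / 2 ^ k < \<epsilon>"
  shows "small \<epsilon> {n. k \<le> col n}"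
proof (rule smallI[OF _ assms])
  fix n
  have "{n. k \<le> col n} \<inter> {0..<n} \<subseteq> (\<lambda>i. 2 ^ k * i) ` {0..n div 2 ^ k}"
  proof
    fix m assume m: "m \<in> {n. k \<le> col n} \<inter> {0..<n}"
    then have "2 ^ k dvd m" using power_col_dvd[of m] le_imp_power_dvd dvd_trans by blast
    then obtain i where i: "m = 2 ^ k * i" by (auto elim: dvdE)
    then have "i \<le> n div 2 ^ k"
      using m by (metis IntE atLeastLessThan_iff div_le_mono less_imp_le nonzero_mult_div_cancel_left
          power_not_zero zero_neq_numeral)
    then show "m \<in> (\<lambda>i. 2 ^ k * i) ` {0..n div 2 ^ k}" using i by auto
  qed
  then have "card ({n. k \<le> col n} \<inter> {0..<n}) \<le> card {0..n div 2 ^ k}"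
    by (meson card_image_le card_mono finite_atLeastAtMost finite_imageI order_trans)
  also have "\<dots> = n div 2 ^ k + 1" by simp
  finally have "real (card ({n. k \<le> col n} \<inter> {0..<n})) \<le> real (n div 2 ^ k) + 1" by linarith
  also have "real (n div 2 ^ k) \<le> real n / 2 ^ k" using of_nat_div_le_of_nat[of n "2 ^ k"] by simp
  finally show "real (card ({n. k \<le> col n} \<inter> {0..<n})) \<le> 1 / 2 ^ k * real n + 1" by simp
qed

lemma half_power_less: "0 < \<epsilon> \<Longrightarrow> \<exists>k. 1 / 2 ^ k < (\<epsilon>::real)"
  using real_arch_pow_inv[of \<epsilon> "1 / 2"] by (simp add: power_divide)

text \<open>For arbitrary partitions this fails, as singletons show. Here finitely many null columns
  are joined with a tail that is small as a whole.\<close>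

lemma null_columns:
  assumes "\<And>e. null {n \<in> B. col n = e}"
  shows "null B"
  unfolding null_def
proof (intro allI impI)
  fix \<epsilon> :: real assume "0 < \<epsilon>"
  then obtain k where k: "1 / 2 ^ k < \<epsilon> / 2" using half_power_less[of "\<epsilon> / 2"] by auto
  have "null {n \<in> B. col n < k}"
  proof (induction k)
    case 0
    show ?case by (simp add: null_finite)
  next
    case (Suc k)
    have "{n \<in> B. col n < Suc k} = {n \<in> B. col n < k} \<union> {n \<in> B. col n = k}" by auto
    then show ?case using null_Un[OF Suc assms] by simp
  qed
  then have "small (\<epsilon> / 2) {n \<in> B. col n < k}" using \<open>0 < \<epsilon>\<close> by (simp add: null_def)
  from small_Un[OF this small_columns[OF k]]
  have "small \<epsilon> ({n \<in> B. col n < k} \<union> {n. k \<le> col n})" by simp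
  then show "small \<epsilon> B" by (rule small_subset) auto
qed

lemma decidable_finite: "finite F \<Longrightarrow> decidable (\<lambda>n. n \<in> F)"
  by (induction F rule: finite_induct) (simp_all add: computable_intros)

text \<open>No uniformity is asked for: for a given \<epsilon> finitely many functions
  \<open>h\<close> are patched together and the remaining columns are left undefined.\<close>

lemma Alpha1_columns:
  assumes "\<And>e. \<exists>h. computable h \<and> (\<forall>n. col n = e \<longrightarrow> h n = g n)"
  shows "satisfies g Alpha1"
  unfolding Alpha1_iff
proof (intro allI impI)
  fix \<epsilon> :: real assume "0 < \<epsilon>"
  then obtain k where k: "1 / 2 ^ k < \<epsilon>" using half_power_less by blast
  have "\<exists>h. computable h \<and> (\<forall>n. col n < k \<longrightarrow> h n = g n)"
  proof (induction k)
    case 0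
    show ?case using computable_const by blast
  next
    case (Suc k)
    then obtain h h' where h: "computable h" "\<forall>n. col n < k \<longrightarrow> h n = g n"
        "computable h'" "\<forall>n. col n = k \<longrightarrow> h' n = g n"
      using assms[of k] by blast
    have "computable (\<lambda>n. if col n = k then h' n else h n)"
      by (intro computable_intros computable_col h)
    moreover have "\<forall>n. col n < Suc k \<longrightarrow> (if col n = k then h' n else h n) = g n"
      using h by (auto simp: less_Suc_eq)
    ultimately show ?case by blast
  qed
  then obtain h where h: "computable h" "\<forall>n. col n < k \<longrightarrow> h n = g n" by blast
  let ?f = "\<lambda>n. if col n < k then Some (h n) else None"
  have "partial_computable ?f"
    by (intro partial_computable_guard computable_intros computable_col h)
  moreover have "{n. ?f n = None} = {n. k \<le> col n}" by (auto simp: not_less[symmetric])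
  ultimately show "\<exists>f. partial_computable f \<and> (\<forall>n. f n = None \<or> f n = Some (g n)) \<and>
      small \<epsilon> {n. f n = None}"
    using h(2) small_columns[OF k] by (intro exI[of _ ?f]) auto
qed

text \<open>Block bounds sum geometrically to \<open>\<delta> * 2 ^ s\<close>, and the power of 2
  above \<open>n\<close> is at most \<open>2 * n\<close>, which gives \<open>2 * \<delta>\<close>.
  The third \<delta> absorbs the blocks before \<open>s\<^sub>0\<close>.\<close>

lemma small_blocks:
  assumes "\<And>s. s\<^sub>0 \<le> s \<Longrightarrow> real (card (M \<inter> block s)) \<le> \<delta> * 2 ^ s" "0 < \<delta>"
  shows "small (3 * \<delta>) M"
proof (rule smallI)
  fix n
  have pow: "real (card (M \<inter> {0..<2 ^ s})) \<le> 2 ^ s\<^sub>0 + \<delta> * 2 ^ s" for s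
  proof (induction s)
    case 0
    have "card (M \<inter> {0..<2 ^ 0}) \<le> card {0..<1::nat}" by (intro card_mono) auto
    moreover have "(1::real) \<le> 2 ^ s\<^sub>0" by simp
    ultimately show ?case using assms(2) by (simp del: one_le_power)
  next
    case (Suc s)
    show ?case
    proof (cases "s\<^sub>0 \<le> s")
      case True
      have "M \<inter> {0..<2 ^ Suc s} = M \<inter> {0..<2 ^ s} \<union> M \<inter> block s"
        by (auto simp: block_def)
      then have "card (M \<inter> {0..<2 ^ Suc s}) \<le> card (M \<inter> {0..<2 ^ s}) + card (M \<inter> block s)"
        by (metis card_Un_le)
      then show ?thesis using Suc assms(1)[OF True] by simp
    next
      case False
      have "card (M \<inter> {0..<2 ^ Suc s}) \<le> card {0..<2 ^ Suc s::nat}" by (intro card_mono) auto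
      also have "\<dots> \<le> 2 ^ s\<^sub>0" using False by (simp add: power_increasing del: power_Suc)
      finally have "real (card (M \<inter> {0..<2 ^ Suc s})) \<le> 2 ^ s\<^sub>0" by (simp flip: of_nat_le_iff)
      moreover have "0 \<le> \<delta> * 2 ^ Suc s" using assms(2) by simp
      ultimately show ?thesis by linarith
    qed
  qed
  show "real (card (M \<inter> {0..<n})) \<le> 2 * \<delta> * real n + 2 ^ s\<^sub>0"
  proof (cases "n = 0")
    case False
    have "card (M \<inter> {0..<n}) \<le> card (M \<inter> {0..<2 ^ Suc (lg n)})"
      using lg_less[of n] by (intro card_mono) auto
    then have "real (card (M \<inter> {0..<n})) \<le> 2 ^ s\<^sub>0 + \<delta> * 2 ^ Suc (lg n)"
      using pow[of "Suc (lg n)"] by linarith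
    also have "\<delta> * 2 ^ Suc (lg n) \<le> 2 * \<delta> * real n"
    proof -
      have "real (2 ^ lg n) \<le> real n" using lg_le[of n] False by (subst of_nat_le_iff) simp
      then show ?thesis using assms(2) by simp
    qed
    finally show ?thesis by simp
  qed simp
qed (use assms(2) in simp)

text \<open>
  On a long block, wait until the partial function has converged on all but a small fraction of the
  block, and answer arbitrarily on the rest.
\<close>

lemma total_approximation:
  assumes f: "partial_computable f" and small: "small (1 / real K) {n. f n \<noteq> Some (g n)}" and "0 < K"
  shows "\<exists>h. computable h \<and> small (7 / real K) {n. h n \<noteq> g n}"
proof -
  obtain e where e: "\<And>n y. f n = Some y \<longleftrightarrow> (\<exists>t. run e n y t)"
    using run_index[OF f] by blast
  obtain s\<^sub>0 where s0: "\<And>s. s\<^sub>0 \<le> s \<Longrightarrow>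
      real (card ({n. f n \<noteq> Some (g n)} \<inter> block s)) \<le> 2 * (1 / real K) * 2 ^ s"
    using small_block[OF small] by (auto simp: eventually_sequentially)
  define conv where "conv n t \<longleftrightarrow> (\<exists>y<t. run e n y t)" for n t
  \<comment> \<open>The threshold is the error bound on a block, multiplied by the natural number
    \<open>K\<close> to be a test between naturals. Blocks before \<open>s\<^sub>0\<close>, where
    nothing is known, pass trivially, so the search for a stage always ends.\<close>
  define enough where "enough s t \<longleftrightarrow> s < s\<^sub>0 \<or>
    K * card {n. n < 2 ^ Suc s \<and> 2 ^ s \<le> n \<and> \<not> conv n t} \<le> 2 * 2 ^ s" for s t
  define \<tau> where "\<tau> s = (LEAST t. enough s t)" for s
  \<comment> \<open>Values seen by stage \<open>\<tau> (lg n)\<close> lie below it, so a converged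
    value is found first; otherwise the search stops at the stage itself, which serves as the
    arbitrary answer.\<close>
  define h where "h n = (LEAST y. run e n y (\<tau> (lg n)) \<or> \<tau> (lg n) \<le> y)" for n
  have enough_ex: "\<exists>t. enough s t" for s
  proof (cases "s < s\<^sub>0")
    case False
    let ?G = "{n \<in> block s. f n = Some (g n)}"
    have "\<forall>n\<in>?G. \<exists>t. run e n (g n) t" using e by blast
    \<comment> \<open>Convergence is guaranteed where \<open>f\<close> is correct; the sum of the
      individual stages is a common one for all these points of the block.\<close>
    then obtain T where T: "\<And>n. n \<in> ?G \<Longrightarrow> run e n (g n) (T n)" by metis
    have conv: "conv n (sum T ?G)" if "n \<in> ?G" for n
    proof -
      have "T n \<le> sum T ?G" using that by (intro member_le_sum) auto
      then have "run e n (g n) (sum T ?G)" using T[OF that] run_mono by blast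
      then show ?thesis unfolding conv_def using run_bound(2) by blast
    qed
    have "card {n. n < 2 ^ Suc s \<and> 2 ^ s \<le> n \<and> \<not> conv n (sum T ?G)}
        \<le> card ({n. f n \<noteq> Some (g n)} \<inter> block s)"
      by (intro card_mono) (use conv in \<open>auto simp: block_def\<close>)
    then have "real K * real (card {n. n < 2 ^ Suc s \<and> 2 ^ s \<le> n \<and> \<not> conv n (sum T ?G)})
        \<le> real K * (2 * (1 / real K) * 2 ^ s)"
      using s0[of s] False by (intro mult_left_mono) linarith+
    also have "\<dots> = real (2 * 2 ^ s)" using \<open>0 < K\<close> by simp
    finally have "enough s (sum T ?G)" unfolding enough_def by (simp only: of_nat_mult[symmetric] of_nat_le_iff simp_thms)
    then show ?thesis by blast
  qed (auto simp: enough_def)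
  have "computable \<tau>"
    unfolding \<tau>_def using enough_ex
  proof (rule computable_Least[rotated])
    show "decidable (\<lambda>z. enough (pi1 z) (pi2 z))"
      unfolding enough_def conv_def by (intro computable_intros decidable_run)
  qed
  then have "computable h"
    unfolding h_def
    by (intro computable_Least computable_intros decidable_run computable_lg computable_comp[OF \<open>computable \<tau>\<close>])
      auto
  moreover have "small (7 / real K) {n. h n \<noteq> g n}"
  proof -
    define M where "M = {n. \<not> conv n (\<tau> (lg n))}"
    have "real (card (M \<inter> block s)) \<le> 2 / real K * 2 ^ s" if "s\<^sub>0 \<le> s" for s
    proof -
      have "enough s (\<tau> s)" unfolding \<tau>_def using enough_ex by (rule LeastI_ex)
      then have "K * card {n. n < 2 ^ Suc s \<and> 2 ^ s \<le> n \<and> \<not> conv n (\<tau> s)} \<le> 2 * 2 ^ s"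
        using that by (simp add: enough_def)
      moreover have "{n. n < 2 ^ Suc s \<and> 2 ^ s \<le> n \<and> \<not> conv n (\<tau> s)} = M \<inter> block s"
        by (auto simp: M_def block_def lg_eqI)
      ultimately have "real (K * card (M \<inter> block s)) \<le> real (2 * 2 ^ s)"
        by (simp only: of_nat_le_iff)
      then show ?thesis using \<open>0 < K\<close> by (simp add: field_simps)
    qed
    then have "small (3 * (2 / real K)) M" using \<open>0 < K\<close> by (intro small_blocks) auto
    from small_Un[OF small this]
    \<comment> \<open>The 7 is 1 for the errors of \<open>f\<close> plus 3 times 2 for the points
      abandoned before convergence.\<close>
    have "small (7 / real K) ({n. f n \<noteq> Some (g n)} \<union> M)" by (simp add: add_divide_distrib[symmetric])
    moreover have "h n = g n" if fn: "f n = Some (g n)" "conv n (\<tau> (lg n))" for n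
    proof -
      obtain y where y: "y < \<tau> (lg n)" "run e n y (\<tau> (lg n))" using fn(2) by (auto simp: conv_def)
      have "y = g n" using e[of n y] y(2) fn(1) by auto
      moreover have "h n = y"
        unfolding h_def
      proof (rule Least_equality)
        fix z assume "run e n z (\<tau> (lg n)) \<or> \<tau> (lg n) \<le> z"
        then show "y \<le> z" using run_fun[OF y(2)] y(1) by auto
      qed (use y in simp)
      ultimately show ?thesis by simp
    qed
    then have "{n. h n \<noteq> g n} \<subseteq> {n. f n \<noteq> Some (g n)} \<union> M" by (auto simp: M_def)
    ultimately show ?thesis by (rule small_subset)
  qed
  ultimately show ?thesis by blast
qed

lemma Gamma1_of_partial:
  assumes "\<And>\<epsilon>. 0 < \<epsilon> \<Longrightarrow> \<exists>f. partial_computable f \<and> small \<epsilon> {n. f n \<noteq> Some (g n)}"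
  shows "satisfies g Gamma1"
  unfolding Gamma1_iff
proof (intro allI impI)
  fix \<epsilon> :: real assume "0 < \<epsilon>"
  obtain K :: nat where K: "7 / \<epsilon> < real K" using reals_Archimedean2 by blast
  then have "0 < real K" using \<open>0 < \<epsilon>\<close> by (smt (verit) divide_pos_pos)
  then obtain f where "partial_computable f" "small (1 / real K) {n. f n \<noteq> Some (g n)}"
    using assms[of "1 / real K"] by auto
  then obtain h where "computable h" "small (7 / real K) {n. h n \<noteq> g n}"
    using total_approximation \<open>0 < real K\<close> by (metis of_nat_0_less_iff)
  moreover have "7 / real K \<le> \<epsilon>" using K \<open>0 < \<epsilon>\<close> \<open>0 < real K\<close> by (simp add: field_simps)
  ultimately show "\<exists>h. computable h \<and> small \<epsilon> {n. h n \<noteq> g n}" using small_mono by blast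
qed

section \<open>The implications along the edges\<close>

lemma EDC_imp_CC: "satisfies g EDC \<Longrightarrow> satisfies g CC"
proof -
  assume "satisfies g EDC"
  then obtain h where h: "computable h" "\<And>n. h n = 0 \<or> h n = Suc (g n)" "null {n. h n = 0}"
    unfolding EDC_iff by blast
  have "{n. h n - 1 \<noteq> g n} \<subseteq> {n. h n = 0}" using h(2) by force
  then have "null {n. h n - 1 \<noteq> g n}" using h(3) null_subset by blast
  moreover have "computable (\<lambda>n. h n - 1)" by (intro computable_intros h)
  ultimately show ?thesis unfolding CC_iff by (intro exI[of _ "\<lambda>n. h n - 1"]) simp
qed

lemma EDC_imp_GC: "satisfies g EDC \<Longrightarrow> satisfies g GC"
proof -
  assume "satisfies g EDC"
  then obtain h where h: "computable h" "\<And>n. h n = 0 \<or> h n = Suc (g n)" "null {n. h n = 0}"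
    unfolding EDC_iff by blast
  let ?f = "\<lambda>n. if 0 < h n then Some (h n - 1) else None"
  have "partial_computable ?f" by (intro partial_computable_guard computable_intros h)
  moreover have "?f n = None \<or> ?f n = Some (g n)" for n using h(2)[of n] by auto
  moreover have "{n. ?f n = None} = {n. h n = 0}" by auto
  ultimately show ?thesis unfolding GC_iff using h(3) by (intro exI[of _ ?f]) simp
qed

lemma CC_imp_DC: "satisfies g CC \<Longrightarrow> satisfies g DC"
proof -
  assume "satisfies g CC"
  then obtain h where "computable h" "null {n. h n \<noteq> g n}" unfolding CC_iff by blast
  then show ?thesis
    unfolding DC_iff by (intro exI[of _ "\<lambda>n. Some (h n)"]) (simp add: partial_computable_Some)
qed

lemma GC_imp_DC: "satisfies g GC \<Longrightarrow> satisfies g DC"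
proof -
  assume "satisfies g GC"
  then obtain f where f: "partial_computable f" "\<And>n. f n = None \<or> f n = Some (g n)" "null {n. f n = None}"
    unfolding GC_iff by blast
  have "{n. f n \<noteq> Some (g n)} \<subseteq> {n. f n = None}" using f(2) by auto
  then show ?thesis unfolding DC_iff using f null_subset by blast
qed

lemma satisfies_edge:
  assumes "(p, q) \<in> edges" "satisfies g p"
  shows "satisfies g q"
proof -
  have "satisfies g Alpha1" if "satisfies g GC"
    using that unfolding GC_iff Alpha1_iff null_def by blast
  moreover have "satisfies g Gamma1" if "satisfies g DC"
    using that by (intro Gamma1_of_partial) (auto simp: DC_iff null_def simp del: satisfies.simps)
  moreover have "satisfies g Gamma1" if \<alpha>: "satisfies g Alpha1"
  proof (rule Gamma1_of_partial)
    fix \<epsilon> :: real assume "0 < \<epsilon>"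
    then obtain f where f: "partial_computable f" "\<And>n. f n = None \<or> f n = Some (g n)"
        "small \<epsilon> {n. f n = None}"
      using \<alpha> unfolding Alpha1_iff by blast
    have "{n. f n \<noteq> Some (g n)} \<subseteq> {n. f n = None}" using f(2) by auto
    then show "\<exists>f. partial_computable f \<and> small \<epsilon> {n. f n \<noteq> Some (g n)}"
      using f small_subset by blast
  qed
  ultimately show ?thesis
    using assms EDC_imp_CC EDC_imp_GC CC_imp_DC GC_imp_DC
    unfolding edges_def by (auto simp del: satisfies.simps)
qed

lemma satisfies_below:
  assumes "q \<preceq> p" "satisfies g p"
  shows "satisfies g q"
proof -
  have "satisfies g q" if "(p, q) \<in> edges\<^sup>+"
    using that assms(2) by (induction rule: trancl_induct) (auto dest: satisfies_edge simp del: satisfies.simps)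
  then show ?thesis using assms unfolding below_def by blast
qed

section \<open>Interleaving\<close>

definition interleave :: "(nat \<Rightarrow> 'a) \<Rightarrow> (nat \<Rightarrow> 'a) \<Rightarrow> nat \<Rightarrow> 'a" where
  "interleave f g n = (if even n then f (n div 2) else g (n div 2))"

lemma interleave_simps [simp]: "interleave f g (2 * n) = f n" "interleave f g (Suc (2 * n)) = g n"
  by (simp_all add: interleave_def)

text \<open>Halving is injective on the even and on the odd numbers, so each half has at most as
  many errors below \<open>n\<close> as the original. The resulting factor 2 is harmless, as
  \<epsilon> is always arbitrary in the end.\<close>

lemma small_interleave:
  assumes "small \<epsilon> {n. P (f n) (a n)}" "small \<epsilon> {n. P (g n) (b n)}"
  shows "small (2 * \<epsilon>) {n. P (interleave f g n) (interleave a b n)}"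
proof -
  have half: "small \<epsilon> {n. Q n \<and> n div 2 \<in> B}" if "small \<epsilon> B" and inj: "inj_on (\<lambda>n. n div 2) {n. Q n}" for B Q
    using that(1) unfolding small_def
  proof eventually_elim
    case (elim n)
    have "card ({n. Q n \<and> n div 2 \<in> B} \<inter> {0..<n}) \<le> card (B \<inter> {0..<n})"
      by (rule card_inj_on_le[of "\<lambda>n. n div 2"]) (auto intro!: inj_on_subset[OF inj])
    then show ?case using elim by linarith
  qed
  have "inj_on (\<lambda>n::nat. n div 2) {n. even n}" "inj_on (\<lambda>n::nat. n div 2) {n. odd n}"
    by (rule inj_onI; simp; presburger)+
  from small_Un[OF half[OF assms(1) this(1)] half[OF assms(2) this(2)]]
  have "small (2 * \<epsilon>) ({n. even n \<and> n div 2 \<in> {n. P (f n) (a n)}} \<union>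
      {n. odd n \<and> n div 2 \<in> {n. P (g n) (b n)}})"
    by simp
  then show ?thesis by (rule small_subset) (auto simp: interleave_def)
qed

text \<open>Since \<open>i\<close> is at most 1, arguments below \<open>n\<close> are sent below
  \<open>2 * n\<close>; comparing these two lengths costs the factor 2.\<close>

lemma small_affine:
  assumes "small \<epsilon> B" "i \<le> (1::nat)"
  shows "small (2 * \<epsilon>) {n. 2 * n + i \<in> B}"
proof -
  have "\<forall>\<^sub>F n in sequentially. real (card (B \<inter> {0..<2 * n})) \<le> \<epsilon> * real (2 * n)"
    using assms(1) unfolding small_def
    by (rule eventually_compose_filterlim) (auto intro!: filterlim_subseq strict_monoI)
  then show ?thesis
    unfolding small_def
  proof eventually_elim
    case (elim n)
    have "card ({n. 2 * n + i \<in> B} \<inter> {0..<n}) \<le> card (B \<inter> {0..<2 * n})"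
      by (rule card_inj_on_le[of "\<lambda>n. 2 * n + i"]) (use assms(2) in \<open>auto intro!: inj_onI\<close>)
    then show ?case using elim by simp
  qed
qed

text \<open>
  All six properties ask for a describing function from some class \<open>K\<close> that meets a pointwise
  constraint \<open>c\<close> and is bad, in the pointwise sense \<open>b\<close>, only on a small set.
\<close>

definition described :: "((nat \<Rightarrow> 'v) \<Rightarrow> bool) \<Rightarrow> ('v \<Rightarrow> nat \<Rightarrow> bool) \<Rightarrow> ('v \<Rightarrow> nat \<Rightarrow> bool) \<Rightarrow>
    (nat \<Rightarrow> nat) \<Rightarrow> real set \<Rightarrow> bool" where
  "described K c b g E \<longleftrightarrow> (\<exists>f. K f \<and> (\<forall>n. c (f n) (g n)) \<and> (\<forall>\<epsilon>\<in>E. small \<epsilon> {n. b (f n) (g n)}))"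

definition uniform_class :: "((nat \<Rightarrow> 'v) \<Rightarrow> bool) \<Rightarrow> bool" where
  "uniform_class K \<longleftrightarrow> (\<forall>f g. K f \<longrightarrow> K g \<longrightarrow> K (interleave f g)) \<and>
     (\<forall>f A. K f \<longrightarrow> computable A \<longrightarrow> K (\<lambda>n. f (A n)))"

lemma uniform_class_computable: "uniform_class computable"
  unfolding uniform_class_def interleave_def
  by (intro conjI allI impI computable_if decidable_even computable_id computable_div2)
    (erule (1) computable_comp | erule computable_comp, intro computable_div2 computable_id)+

lemma uniform_class_partial_computable: "uniform_class partial_computable"
  unfolding uniform_class_def interleave_def
  by (intro conjI allI impI partial_computable_if decidable_even computable_id computable_div2)
    (assumption | erule (1) partial_computable_comp)+

lemma described_interleave:
  assumes "uniform_class K" "described K c b g E" "described K c b g' E"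
  shows "described K c b (interleave g g') ((*) 2 ` E)"
proof -
  obtain f f' where f: "K f" "\<forall>n. c (f n) (g n)" "\<forall>\<epsilon>\<in>E. small \<epsilon> {n. b (f n) (g n)}"
    and f': "K f'" "\<forall>n. c (f' n) (g' n)" "\<forall>\<epsilon>\<in>E. small \<epsilon> {n. b (f' n) (g' n)}"
    using assms(2,3) unfolding described_def by blast
  have "K (interleave f f')" using assms(1) f f' by (simp add: uniform_class_def)
  moreover have "\<forall>n. c (interleave f f' n) (interleave g g' n)"
    using f f' by (simp add: interleave_def)
  moreover have "\<forall>\<epsilon>\<in>(*) 2 ` E. small \<epsilon> {n. b (interleave f f' n) (interleave g g' n)}"
    using f f' small_interleave[of _ b] by blast
  ultimately show ?thesis unfolding described_def by blast
qed

lemma described_affine: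
  assumes "uniform_class K" "described K c b g E" "i \<le> (1::nat)"
  shows "described K c b (\<lambda>n. g (2 * n + i)) ((*) 2 ` E)"
proof -
  obtain f where f: "K f" "\<forall>n. c (f n) (g n)" "\<forall>\<epsilon>\<in>E. small \<epsilon> {n. b (f n) (g n)}"
    using assms(2) unfolding described_def by blast
  have "computable (\<lambda>n. 2 * n + i)" by (intro computable_intros)
  then have "K (\<lambda>n. f (2 * n + i))"
    by (rule assms(1)[unfolded uniform_class_def, THEN conjunct2, rule_format, OF f(1)])
  moreover have "\<forall>\<epsilon>\<in>(*) 2 ` E. small \<epsilon> {n. b (f (2 * n + i)) (g (2 * n + i))}"
    using f(3) small_affine[OF _ assms(3), of _ "{n. b (f n) (g n)}"] by auto
  ultimately show ?thesis using f(2) unfolding described_def by blast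
qed

lemma times_2_greaterThan_0: "(*) 2 ` {0<..} = ({0<..} :: real set)"
proof -
  have "x \<in> (*) 2 ` {0<..}" if "0 < x" for x :: real
    using that by (intro image_eqI[of _ _ "x / 2"]) auto
  then show ?thesis by auto
qed

text \<open>The factor 2 in \<epsilon> disappears because both requirements, one description for all
  positive \<epsilon> and one for each positive \<epsilon>, are invariant under doubling.\<close>

lemma described_interleave_iff:
  assumes "uniform_class K"
  shows "described K c b (interleave g g') {0<..} \<longleftrightarrow> described K c b g {0<..} \<and> described K c b g' {0<..}"
    and "(\<forall>\<epsilon>>0. described K c b (interleave g g') {\<epsilon>}) \<longleftrightarrow>
      (\<forall>\<epsilon>>0. described K c b g {\<epsilon>}) \<and> (\<forall>\<epsilon>>0. described K c b g' {\<epsilon>})"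
proof -
  have aff: "described K c b g ((*) 2 ` E) \<and> described K c b g' ((*) 2 ` E)"
    if "described K c b (interleave g g') E" for E
    using described_affine[OF assms that, of 0] described_affine[OF assms that, of 1] by simp
  show "described K c b (interleave g g') {0<..} \<longleftrightarrow> described K c b g {0<..} \<and> described K c b g' {0<..}"
    using aff[of "{0<..}"] described_interleave[OF assms, of c b g "{0<..}" g']
    by (auto simp: times_2_greaterThan_0)
  have half: "(\<forall>\<epsilon>>0. X ((*) 2 ` {\<epsilon>})) \<longleftrightarrow> (\<forall>\<epsilon>>0. X {\<epsilon>})" for X :: "real set \<Rightarrow> bool"
  proof safe
    fix \<epsilon> :: real assume "\<forall>\<epsilon>>0. X ((*) 2 ` {\<epsilon>})" "0 < \<epsilon>"
    from this(1)[rule_format, of "\<epsilon> / 2"] this(2) show "X {\<epsilon>}" by simp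
  qed simp
  show "(\<forall>\<epsilon>>0. described K c b (interleave g g') {\<epsilon>}) \<longleftrightarrow>
      (\<forall>\<epsilon>>0. described K c b g {\<epsilon>}) \<and> (\<forall>\<epsilon>>0. described K c b g' {\<epsilon>})"
  proof (intro iffI)
    assume "\<forall>\<epsilon>>0. described K c b (interleave g g') {\<epsilon>}"
    then have "(\<forall>\<epsilon>>0. described K c b g ((*) 2 ` {\<epsilon>})) \<and> (\<forall>\<epsilon>>0. described K c b g' ((*) 2 ` {\<epsilon>}))"
      using aff by blast
    then show "(\<forall>\<epsilon>>0. described K c b g {\<epsilon>}) \<and> (\<forall>\<epsilon>>0. described K c b g' {\<epsilon>})"
      unfolding half .
  next
    assume "(\<forall>\<epsilon>>0. described K c b g {\<epsilon>}) \<and> (\<forall>\<epsilon>>0. described K c b g' {\<epsilon>})"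
    then have "\<forall>\<epsilon>>0. described K c b (interleave g g') ((*) 2 ` {\<epsilon>})"
      using described_interleave[OF assms] by blast
    then show "\<forall>\<epsilon>>0. described K c b (interleave g g') {\<epsilon>}"
      unfolding half .
  qed
qed

text \<open>With \<open>{0<..}\<close> one description must have a null error set; with
  \<open>{\<epsilon>}\<close> it may depend on \<epsilon>. This is the whole difference between gc
  and \<alpha> = 1, and between cc and \<gamma> = 1.\<close>

lemma satisfies_described:
  "satisfies g EDC \<longleftrightarrow> described computable (\<lambda>v y. v = 0 \<or> v = Suc y) (\<lambda>v y. v = 0) g {0<..}"
  "satisfies g CC \<longleftrightarrow> described computable (\<lambda>v y. True) (\<lambda>v y. v \<noteq> y) g {0<..}"
  "satisfies g GC \<longleftrightarrow> described partial_computable (\<lambda>v y. v = None \<or> v = Some y) (\<lambda>v y. v = None) g {0<..}"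
  "satisfies g DC \<longleftrightarrow> described partial_computable (\<lambda>v y. True) (\<lambda>v y. v \<noteq> Some y) g {0<..}"
  "satisfies g Alpha1 \<longleftrightarrow>
     (\<forall>\<epsilon>>0. described partial_computable (\<lambda>v y. v = None \<or> v = Some y) (\<lambda>v y. v = None) g {\<epsilon>})"
  "satisfies g Gamma1 \<longleftrightarrow> (\<forall>\<epsilon>>0. described computable (\<lambda>v y. True) (\<lambda>v y. v \<noteq> y) g {\<epsilon>})"
  unfolding EDC_iff CC_iff GC_iff DC_iff Alpha1_iff Gamma1_iff described_def null_def by auto

lemma satisfies_interleave: "satisfies (interleave g g') p \<longleftrightarrow> satisfies g p \<and> satisfies g' p"
  by (cases p) (simp_all only: satisfies_described
      described_interleave_iff[OF uniform_class_computable]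
      described_interleave_iff[OF uniform_class_partial_computable])

lemma ce_set_interleave:
  assumes "ce_set A" "ce_set B"
  shows "\<exists>C. ce_set C \<and> (indicator C :: nat \<Rightarrow> nat) = interleave (indicator A) (indicator B)"
proof -
  obtain f g where f: "partial_computable f" "dom f = A" and g: "partial_computable g" "dom g = B"
    using assms by (auto simp: ce_set_def)
  have "partial_computable (interleave f g)"
    using uniform_class_partial_computable f(1) g(1) by (simp add: uniform_class_def)
  then have "ce_set (dom (interleave f g))" by (auto simp: ce_set_def)
  moreover have "(indicator (dom (interleave f g)) :: nat \<Rightarrow> nat) = interleave (indicator A) (indicator B)"
    by (auto simp: fun_eq_iff interleave_def indicator_def f(2)[symmetric] g(2)[symmetric] dom_def)
  ultimately show ?thesis by blast
qed

section \<open>The separating sets\<close>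

lemma computable_index:
  assumes "computable h"
  obtains e where "\<And>n y. h n = y \<longleftrightarrow> (\<exists>t. run e n y t)"
  using run_index[OF partial_computable_Some[OF assms]] by (metis option.inject)

text \<open>Program \<open>e\<close> owns all blocks \<open>s\<close> with \<open>col s = e\<close>,
  infinitely many, and a total one is contradicted at every point of them. The damage to a block is
  thus the same for all \<open>e\<close>.\<close>

lemma not_Gamma1_example:
  defines "C \<equiv> {n. \<exists>t. run (col (lg n)) n 0 t}"
  shows "ce_set C" "\<not> satisfies (indicator C) Gamma1"
proof -
  show "ce_set C"
    unfolding C_def by (intro ce_setI computable_intros decidable_run computable_col computable_lg)
  show "\<not> satisfies (indicator C) Gamma1"
  proof
    assume "satisfies (indicator C) Gamma1"
    \<comment> \<open>Passing to a block doubles the bound to 1/4, while an owned block is wrong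
      entirely.\<close>
    then obtain h where h: "computable h" "small (1 / 8) {n. h n \<noteq> indicator C n}"
      unfolding Gamma1_iff by (meson zero_less_divide_1_iff zero_less_numeral)
    obtain e where e: "\<And>n y. h n = y \<longleftrightarrow> (\<exists>t. run e n y t)"
      using computable_index[OF h(1)] by blast
    obtain N where N: "\<And>s. N \<le> s \<Longrightarrow>
        real (card ({n. h n \<noteq> indicator C n} \<inter> block s)) \<le> 2 * (1 / 8) * 2 ^ s"
      using small_block[OF h(2)] by (auto simp: eventually_sequentially)
    \<comment> \<open>A block number in column \<open>e\<close> that exceeds
      \<open>N\<close>.\<close>
    define s where "s = 2 ^ e * (2 * N + 1)"
    have s: "N \<le> s" "col s = e" unfolding s_def using odd_part_le[of N e] by (simp_all only: col_eq less_imp_le)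
    have "h n \<noteq> indicator C n" if "n \<in> block s" for n
    proof -
      have "n \<in> C \<longleftrightarrow> h n = 0" unfolding C_def e by (simp add: lg_block[OF that] s)
      then show ?thesis by (auto simp: indicator_def)
    qed
    then have "{n. h n \<noteq> indicator C n} \<inter> block s = block s" by auto
    then have "(2::real) ^ s \<le> 2 * (1 / 8) * 2 ^ s" using N[OF s(1)] by (simp add: card_block)
    then show False by simp
  qed
qed

section \<open>Expansionary stages and the failures of cc and edc\<close>

definition conv_upto :: "nat \<Rightarrow> nat \<Rightarrow> nat \<Rightarrow> bool" where
  "conv_upto e j s \<longleftrightarrow> (\<forall>i<Suc j. \<exists>y<s. run e i y s)"

text \<open>
  Stages at which a longer initial segment of program \<open>e\<close> is seen to converge: there are infinitely
  many of them if the program is total, and finitely many otherwise.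
\<close>

definition expansionary :: "nat \<Rightarrow> nat \<Rightarrow> bool" where
  "expansionary e s \<longleftrightarrow> (\<exists>j<s. conv_upto e j s \<and> \<not> conv_upto e j (s - 1))"

lemma decidable_expansionary:
  assumes "computable A" "computable B"
  shows "decidable (\<lambda>x. expansionary (A x) (B x))"
  unfolding expansionary_def conv_upto_def
  by (intro computable_intros decidable_run assms assms[THEN computable_comp])

lemma conv_upto_mono: "conv_upto e j s \<Longrightarrow> s \<le> t \<Longrightarrow> conv_upto e j t"
  unfolding conv_upto_def by (meson run_mono less_le_trans)

text \<open>The first stage at which the arguments up to \<open>N\<close> have all converged is
  expansionary, and it exceeds \<open>N\<close> because \<open>run\<close> keeps arguments below the
  stage.\<close>

lemma expansionary_unbounded:
  assumes "\<And>n. \<exists>y t. run e n y t"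
  shows "\<exists>s\<ge>N. expansionary e s"
proof -
  obtain Y T where T: "\<And>n. run e n (Y n) (T n)" using assms by metis
  have "conv_upto e N (sum T {..<Suc N})"
    unfolding conv_upto_def
  proof (intro allI impI)
    fix i assume "i < Suc N"
    then have "T i \<le> sum T {..<Suc N}" by (intro member_le_sum) auto
    then have "run e i (Y i) (sum T {..<Suc N})" using T run_mono by blast
    then show "\<exists>y<sum T {..<Suc N}. run e i y (sum T {..<Suc N})" using run_bound(2) by blast
  qed
  then obtain s where s: "conv_upto e N s" "\<forall>t<s. \<not> conv_upto e N t"
    by (metis exists_least_iff)
  have "N < s" using s(1) run_bound(1) unfolding conv_upto_def by blast
  then show ?thesis using s unfolding expansionary_def by (intro exI[of _ s]) auto
qed

text \<open>An expansionary stage is the first stage of convergence up to some \<open>j\<close>, and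
  divergence at \<open>n\<close> forces \<open>j < n\<close>.\<close>

lemma expansionary_finite:
  assumes "\<nexists>y t. run e n y t"
  shows "finite {s. expansionary e s}"
proof (rule finite_subset)
  show "{s. expansionary e s} \<subseteq> (\<lambda>j. LEAST s. conv_upto e j s) ` {..<n}"
  proof
    fix s assume "s \<in> {s. expansionary e s}"
    then obtain j where j: "j < s" "conv_upto e j s" "\<not> conv_upto e j (s - 1)"
      by (auto simp: expansionary_def)
    have "j < n" using j(2) assms unfolding conv_upto_def by (meson not_less_eq)
    moreover have "(LEAST s. conv_upto e j s) = s"
    proof (rule Least_equality[of "conv_upto e j", OF j(2)])
      fix t assume "conv_upto e j t"
      then show "s \<le> t" using j(3) conv_upto_mono[of e j t "s - 1"] by linarith
    qed
    ultimately show "s \<in> (\<lambda>j. LEAST s. conv_upto e j s) ` {..<n}" by force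
  qed
qed simp

lemma finite_lg: "finite S \<Longrightarrow> finite {n. lg n \<in> S}"
proof -
  assume "finite S"
  then have "finite (\<Union>s\<in>S. {..<2 ^ Suc s :: nat})" by blast
  then show ?thesis by (rule rev_finite_subset) (use lg_less in auto)
qed

text \<open>The points at which waiting for the program is in vain: none in the column of a total
  program, finitely many in that of a nontotal one.\<close>

lemma null_nonconvergent:
  "null {n. expansionary (col n) (lg n) \<and> \<not> (\<exists>y t. run (col n) n y t)}" (is "null ?B")
proof (rule null_columns)
  fix e
  show "null {n \<in> ?B. col n = e}"
  proof (cases "\<forall>n. \<exists>y t. run e n y t")
    case True
    then have "{n \<in> ?B. col n = e} = {}" by auto
    then show ?thesis using null_finite[OF finite.emptyI] by argo
  next
    case False
    then have "finite {n. lg n \<in> {s. expansionary e s}}"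
      using expansionary_finite finite_lg by blast
    then show ?thesis by (intro null_finite) (rule rev_finite_subset, auto)
  qed
qed

lemma null_frequently_cell:
  assumes "null B" "\<And>N. \<exists>s\<ge>N. card (cell e s) \<le> 2 * card (B \<inter> cell e s)"
  shows False
proof -
  obtain N where "\<And>s. N \<le> s \<Longrightarrow> 2 * card (B \<inter> cell e s) < card (cell e s)"
    using null_cell[OF assms(1)] by (auto simp: eventually_sequentially)
  then show False using assms(2)[of N] by (meson not_le)
qed

lemma cellD: "n \<in> cell e s \<Longrightarrow> col n = e" "n \<in> cell e s \<Longrightarrow> lg n = s"
  by (simp_all add: cell_def lg_block)

text \<open>
  The set differs from a total \<open>e\<close>-th function on infinitely many cells of column \<open>e\<close>, while
  outside the expansionary cells it is known to be empty.
\<close>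

lemma not_CC_example:
  defines "C \<equiv> {n. \<exists>t. expansionary (col n) (lg n) \<and> run (col n) n 0 t}"
  shows "ce_set C" "satisfies (indicator C) GC" "\<not> satisfies (indicator C) CC"
proof -
  show "ce_set C"
    unfolding C_def
    by (intro ce_setI computable_intros decidable_run decidable_expansionary computable_col computable_lg)
  \<comment> \<open>Outside expansionary cells any witness serves and the answer is 0; inside,
    \<open>w\<close> must code the output of the program and a stage, and that output decides
    membership in \<open>C\<close>.\<close>
  let ?P = "\<lambda>n w. \<not> expansionary (col n) (lg n) \<or> run (col n) n (pi1 w) (pi2 w)"
  let ?F = "\<lambda>n w. if \<not> expansionary (col n) (lg n) then 0 else if pi1 w = 0 then 1 else (0::nat)"
  let ?f = "\<lambda>n. if \<exists>w. ?P n w then Some (?F n (LEAST w. ?P n w)) else None"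
  have "partial_computable ?f"
    by (intro partial_computable_search computable_intros decidable_run decidable_expansionary
        computable_col computable_lg)
  moreover have "?f n = None \<or> ?f n = Some (indicator C n)" for n
  proof (cases "\<exists>w. ?P n w")
    case True
    then have *: "?P n (LEAST w. ?P n w)" by (rule LeastI_ex)
    have "?F n w = indicator C n" if "?P n w" for w
      using that by (auto simp: C_def indicator_def dest: run_fun)
    then have "?F n (LEAST w. ?P n w) = indicator C n" using * by blast
    then show ?thesis by simp
  qed simp
  moreover have "null {n. ?f n = None}"
  proof (rule null_subset[OF null_nonconvergent])
    show "{n. ?f n = None} \<subseteq> {n. expansionary (col n) (lg n) \<and> \<not> (\<exists>y t. run (col n) n y t)}"
      by (auto split: if_splits) (metis pi1_pair pi2_pair)
  qed
  ultimately show "satisfies (indicator C) GC" unfolding GC_iff by blast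
  show "\<not> satisfies (indicator C) CC"
  proof
    assume "satisfies (indicator C) CC"
    then obtain h where h: "computable h" "null {n. h n \<noteq> indicator C n}" unfolding CC_iff by blast
    obtain e where e: "\<And>n y. h n = y \<longleftrightarrow> (\<exists>t. run e n y t)"
      using computable_index[OF h(1)] by blast
    show False
    proof (rule null_frequently_cell[OF h(2)])
      fix N
      obtain s where s: "N \<le> s" "expansionary e s"
        using expansionary_unbounded[of e N] e by blast
      have "h n \<noteq> indicator C n" if n: "n \<in> cell e s" for n
      proof -
        have "n \<in> C \<longleftrightarrow> h n = 0" unfolding C_def e using s by (simp add: cellD[OF n])
        then show ?thesis by (auto simp: indicator_def)
      qed
      then have "{n. h n \<noteq> indicator C n} \<inter> cell e s = cell e s" by auto
      then show "\<exists>s\<ge>N. card (cell e s) \<le> 2 * card ({n. h n \<noteq> indicator C n} \<inter> cell e s)"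
        using s(1) by (intro exI[of _ s]) simp
    qed
  qed
qed

lemma partial_computable_ce:
  assumes "ce_set C"
  shows "partial_computable (\<lambda>n. if n \<in> C then Some c else None)"
proof -
  obtain f where f: "partial_computable f" "dom f = C" using assms by (auto simp: ce_set_def)
  obtain e where e: "\<And>n y. f n = Some y \<longleftrightarrow> (\<exists>t. run e n y t)" using run_index[OF f(1)] by blast
  have "n \<in> C \<longleftrightarrow> (\<exists>w. run e n (pi1 w) (pi2 w))" for n
    using e[of n] f(2) by (metis domD domIff option.distinct(1) pi1_pair pi2_pair)
  moreover have "partial_computable (\<lambda>n. if \<exists>w. run e n (pi1 w) (pi2 w) then Some c else None)"
    by (rule partial_computable_search[where F = "\<lambda>_ _. c"]) (intro computable_intros decidable_run)+
  ultimately show ?thesis by simp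
qed

lemma finite_at_most_one: "(\<And>x y. x \<in> S \<Longrightarrow> y \<in> S \<Longrightarrow> x = y) \<Longrightarrow> finite S"
  by (metis finite.emptyI finite_insert finite_subset insertCI subsetI)

text \<open>
  Expansionary cells of column \<open>e\<close> are withheld from \<open>C\<close> until program \<open>e\<close> commits itself; the
  output \<open>2 = box_code (Val 1)\<close> is answered by keeping that one element out forever.
\<close>

lemma not_EDC_example:
  defines "C \<equiv> {n. \<exists>t. \<not> expansionary (col n) (lg n) \<or> (\<exists>y<t. run (col n) n y t \<and> y \<noteq> 2) \<or>
    (\<exists>m<n. col m = col n \<and> expansionary (col n) (lg m) \<and> run (col n) m 2 t)}"
  shows "ce_set C" "satisfies (indicator C) GC" "satisfies (indicator C) CC"
    "\<not> satisfies (indicator C) EDC"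
proof -
  show ce: "ce_set C"
    unfolding C_def
    by (intro ce_setI computable_intros decidable_run decidable_expansionary computable_col computable_lg)
  have C_iff: "n \<in> C \<longleftrightarrow> \<not> expansionary (col n) (lg n) \<or> (\<exists>y t. run (col n) n y t \<and> y \<noteq> 2) \<or>
    (\<exists>m<n. col m = col n \<and> expansionary (col n) (lg m) \<and> (\<exists>t. run (col n) m 2 t))" for n
  proof -
    have "(\<exists>y<t. run (col n) n y t \<and> y \<noteq> 2) \<longleftrightarrow> (\<exists>y. run (col n) n y t \<and> y \<noteq> 2)" for t
      using run_bound(2) by blast
    then show ?thesis unfolding C_def mem_Collect_eq by (simp only: ex_disj_distrib) blast
  qed
  \<comment> \<open>The points kept out in answer to an output 2. Each column has at most one, since
    the third clause of \<open>C\<close> admits every later point of the column.\<close>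
  define M where "M = {n. expansionary (col n) (lg n) \<and> (\<exists>t. run (col n) n 2 t) \<and> n \<notin> C}"
  have "null M"
  proof (rule null_columns)
    fix e
    show "null {n \<in> M. col n = e}"
    proof (rule null_finite, rule finite_at_most_one)
      fix x y assume xy: "x \<in> {n \<in> M. col n = e}" "y \<in> {n \<in> M. col n = e}"
      have False if "x < y" "x \<in> M" "y \<in> M" "col x = col y" for x y
      proof -
        have "y \<notin> C" "expansionary (col y) (lg x)" "\<exists>t. run (col y) x 2 t"
          using that unfolding M_def by simp_all
        then show False using that(1,4) unfolding C_iff by blast
      qed
      from this[of x y] this[of y x] xy show "x = y" by (cases x y rule: linorder_cases) simp_all
    qed
  qed
  moreover have "- C \<subseteq> {n. expansionary (col n) (lg n) \<and> \<not> (\<exists>y t. run (col n) n y t)} \<union> M"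
  proof
    fix n assume "n \<in> - C"
    then have "expansionary (col n) (lg n)" "\<And>y t. run (col n) n y t \<Longrightarrow> y = 2" "n \<notin> C"
      unfolding Compl_iff C_iff by blast+
    then show "n \<in> {n. expansionary (col n) (lg n) \<and> \<not> (\<exists>y t. run (col n) n y t)} \<union> M"
      unfolding M_def by blast
  qed
  ultimately have null: "null (- C)"
    by (rule null_subset[OF null_Un[OF null_nonconvergent]])
  have "{n. (1::nat) \<noteq> indicator C n} = - C" by (auto simp: indicator_def)
  then show "satisfies (indicator C) CC"
    unfolding CC_iff using null computable_const[of 1] by (intro exI[of _ "\<lambda>n. 1"]) simp
  let ?f = "\<lambda>n. if n \<in> C then Some (1::nat) else None"
  have "{n. ?f n = None} = - C" by auto
  then show "satisfies (indicator C) GC"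
    unfolding GC_iff using null partial_computable_ce[OF ce, of 1]
    by (intro exI[of _ ?f]) (simp add: indicator_def)
  show "\<not> satisfies (indicator C) EDC"
  proof
    assume "satisfies (indicator C) EDC"
    then obtain h where h: "computable h" "\<And>n. h n = 0 \<or> h n = Suc (indicator C n)" "null {n. h n = 0}"
      unfolding EDC_iff by blast
    obtain e where e: "\<And>n y. h n = y \<longleftrightarrow> (\<exists>t. run e n y t)"
      using computable_index[OF h(1)] by blast
    have r: "h n = y" if "run e n y t" for n y t
      using e[of n y] that by blast
    \<comment> \<open>\<open>G n\<close> says that \<open>h\<close> claims \<open>n\<close> to be in
      \<open>C\<close>. At the least such point no clause of \<open>C\<close> applies, so the claim
      is false there and \<open>G\<close> never holds.\<close>
    define G where "G n \<longleftrightarrow> col n = e \<and> expansionary e (lg n) \<and> h n = 2" for n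
    have noG: "\<not> G n" for n
    proof
      assume "G n"
      then obtain m where m: "G m" "\<forall>k<m. \<not> G k" by (metis exists_least_iff)
      have "m \<notin> C"
      proof
        assume "m \<in> C"
        then consider "\<not> expansionary e (lg m)" | y t where "run e m y t" "y \<noteq> 2"
          | k t where "k < m" "col k = e" "expansionary e (lg k)" "run e k 2 t"
          using m(1) unfolding C_iff G_def by metis
        then show False
        proof cases
          case 1
          then show False using m(1) by (simp add: G_def)
        next
          case 2
          then show False using r[of m] m(1) by (simp add: G_def)
        next
          case 3
          then have "G k" using r[of k] by (simp add: G_def)
          then show False using m(2) 3(1) by blast
        qed
      qed
      then show False using h(2)[of m] m(1) by (simp add: G_def indicator_def)
    qed
    \<comment> \<open>Any output other than 2, including 0, puts \<open>n\<close> into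
      \<open>C\<close>; a nonzero one would then have to be 2.\<close>
    have zero: "h n = 0" if "col n = e" "expansionary e (lg n)" for n
    proof (rule ccontr)
      assume nz: "h n \<noteq> 0"
      have "h n \<noteq> 2" using noG[of n] that by (simp add: G_def)
      moreover obtain t where "run e n (h n) t" using e[of n "h n"] by blast
      ultimately have "n \<in> C" using that(1) unfolding C_iff by blast
      then show False using h(2)[of n] nz \<open>h n \<noteq> 2\<close> by simp
    qed
    show False
    proof (rule null_frequently_cell[OF h(3)])
      fix N
      obtain s where s: "N \<le> s" "expansionary e s"
        using expansionary_unbounded[of e N] e by blast
      have "{n. h n = 0} \<inter> cell e s = cell e s" using zero s(2) cellD by fastforce
      then show "\<exists>s\<ge>N. card (cell e s) \<le> 2 * card ({n. h n = 0} \<inter> cell e s)"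
        using s(1) by (intro exI[of _ s]) simp
    qed
  qed
qed

section \<open>Post's construction and the failures of gc and \<alpha> = 1\<close>

definition found :: "(nat \<Rightarrow> nat \<Rightarrow> bool) \<Rightarrow> nat \<Rightarrow> nat \<Rightarrow> bool" where
  "found U e w \<longleftrightarrow> U e (pi1 w) \<and> run e (pi1 w) 0 (pi2 w)"

text \<open>Post's simple set construction: from each region \<open>U e\<close> at most one number
  is taken for program \<open>e\<close>, the one in the least coded event of an output 0. A partial
  function with index \<open>e\<close> that never errs can then output 0 nowhere in its region,
  provided the region starts at \<open>e\<close> or later.\<close>

definition first_zeros :: "(nat \<Rightarrow> nat \<Rightarrow> bool) \<Rightarrow> nat set" where
  "first_zeros U = {n. \<exists>t. \<exists>e<Suc n. found U e (pair n t) \<and> (\<forall>w<pair n t. \<not> found U e w)}"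

lemma ce_first_zeros:
  assumes "decidable (\<lambda>z. U (pi1 z) (pi2 z))"
  shows "ce_set (first_zeros U)"
proof -
  have U: "decidable (\<lambda>x. U (A x) (B x))" if "computable A" "computable B" for A B
    using decidable_comp[OF assms computable_pair[OF that]] by simp
  show ?thesis
    unfolding first_zeros_def found_def
    by (intro ce_setI computable_intros decidable_run U)
qed

text \<open>The least coded event supplies the number. The last hypothesis ensures that the bound
  \<open>e<Suc n\<close> in \<open>first_zeros\<close> lets program \<open>e\<close> act.\<close>

lemma first_zeros_meets:
  assumes "U e n" "run e n 0 t" "\<And>m. U e m \<Longrightarrow> e \<le> m"
  shows "\<exists>m t. m \<in> first_zeros U \<and> U e m \<and> run e m 0 t"
proof -
  have "found U e (pair n t)" using assms by (simp add: found_def)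
  then obtain w where w: "found U e w" "\<forall>w'<w. \<not> found U e w'" by (metis exists_least_iff)
  have "pi1 w \<in> first_zeros U"
    unfolding first_zeros_def mem_Collect_eq
    using w assms(3)[of "pi1 w"] by (intro exI[of _ "pi2 w"] exI[of _ e]) (auto simp: found_def)
  then show ?thesis using w(1) by (auto simp: found_def)
qed

text \<open>\<open>i n\<close> is a program responsible for \<open>n\<close>; it is injective
  because least events are unique. Size estimates for the set become counts of programs.\<close>

lemma first_zeros_index:
  obtains i where "\<And>n. n \<in> first_zeros U \<Longrightarrow> U (i n) n" "inj_on i (first_zeros U)"
proof -
  let ?Q = "\<lambda>n e. \<exists>t. found U e (pair n t) \<and> (\<forall>w<pair n t. \<not> found U e w)"
  define i where "i n = (SOME e. ?Q n e)" for n
  have i: "?Q n (i n)" if "n \<in> first_zeros U" for n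
    unfolding i_def by (rule someI_ex) (use that in \<open>auto simp: first_zeros_def\<close>)
  have "U (i n) n" if "n \<in> first_zeros U" for n
    using i[OF that] by (auto simp: found_def)
  moreover have "inj_on i (first_zeros U)"
  proof (rule inj_onI)
    fix n m assume nm: "n \<in> first_zeros U" "m \<in> first_zeros U" "i n = i m"
    obtain t u where "found U (i n) (pair n t)" "\<forall>w<pair n t. \<not> found U (i n) w"
        "found U (i n) (pair m u)" "\<forall>w<pair m u. \<not> found U (i n) w"
      using i[OF nm(1)] i[OF nm(2)] nm(3) by auto
    then have "pair n t = pair m u" by (metis linorder_neqE_nat)
    then show "n = m" by simp
  qed
  ultimately show ?thesis using that by blast
qed

text \<open>With columns as regions, \<open>C\<close> has at most one element per column: it is
  null, and each column is decidable. A correct partial function cannot answer 0 on its column and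
  so is undefined on all but at most one of its points.\<close>

lemma not_GC_example:
  defines "C \<equiv> first_zeros (\<lambda>e n. col n = e)"
  shows "ce_set C" "satisfies (indicator C) CC" "satisfies (indicator C) Alpha1"
    "\<not> satisfies (indicator C) GC"
proof -
  show "ce_set C"
    unfolding C_def by (intro ce_first_zeros computable_intros computable_col)
  have fin: "finite {n \<in> C. col n = e}" for e
  proof (rule finite_at_most_one)
    fix x y assume xy: "x \<in> {n \<in> C. col n = e}" "y \<in> {n \<in> C. col n = e}"
    obtain i where i: "\<And>n. n \<in> C \<Longrightarrow> col n = i n" "inj_on i C"
      unfolding C_def by (rule first_zeros_index[of "\<lambda>e n. col n = e"]) blast
    have "i x = i y" using xy i(1)[of x] i(1)[of y] by simp
    then show "x = y" using xy i(2) by (auto dest: inj_onD)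
  qed
  have "null C" by (rule null_columns, rule null_finite, rule fin)
  moreover have "{n. (0::nat) \<noteq> indicator C n} = C" by (auto simp: indicator_def)
  ultimately show "satisfies (indicator C) CC"
    unfolding CC_iff using computable_const[of 0] by (intro exI[of _ "\<lambda>n. 0"]) simp
  show "satisfies (indicator C) Alpha1"
  proof (rule Alpha1_columns)
    fix e
    have "computable (\<lambda>n. of_bool (n \<in> {n \<in> C. col n = e}))"
      using decidable_finite[OF fin] by (simp add: decidable_def)
    then show "\<exists>h. computable h \<and> (\<forall>n. col n = e \<longrightarrow> h n = indicator C n)"
      by (intro exI conjI) (auto simp: indicator_def)
  qed
  show "\<not> satisfies (indicator C) GC"
  proof
    assume "satisfies (indicator C) GC"
    then obtain f where f: "partial_computable f" "\<And>n. f n = None \<or> f n = Some (indicator C n)"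
        "null {n. f n = None}"
      unfolding GC_iff by blast
    obtain e where e: "\<And>n y. f n = Some y \<longleftrightarrow> (\<exists>t. run e n y t)" using run_index[OF f(1)] by blast
    have nz: "f n \<noteq> Some 0" if n: "col n = e" for n
    proof
      assume "f n = Some 0"
      then obtain t where "run e n 0 t" using e by blast
      then obtain m t where "m \<in> C" "run e m 0 t"
        unfolding C_def using first_zeros_meets[of "\<lambda>e n. col n = e" e n t] n col_le by blast
      then have "f m = Some 0" "m \<in> C" using e by blast+
      then show False using f(2)[of m] by simp
    qed
    have "null ({n. f n = None} \<union> {n \<in> C. col n = e})" (is "null ?B")
      by (rule null_Un[OF f(3) null_finite[OF fin]])
    then show False
    proof (rule null_frequently_cell)
      have "n \<in> ?B" if "col n = e" for n
        using f(2)[of n] nz[OF that] that by (cases "n \<in> C") auto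
      then have "?B \<inter> cell e s = cell e s" for s using cellD by blast
      then show "\<exists>s\<ge>N. card (cell e s) \<le> 2 * card (?B \<inter> cell e s)" for N
        by (intro exI[of _ N]) simp
    qed
  qed
qed

text \<open>Regions must be cofinite, so that a correct partial function is defined only on
  \<open>C\<close> and finitely many other points. The quadratic threshold keeps \<open>C\<close>
  null, with on the order of \<open>sqrt n\<close> elements below \<open>n\<close> at most; a linear
  one would bound only its upper density.\<close>

lemma not_Alpha1_example:
  defines "C \<equiv> first_zeros (\<lambda>e n. e * e \<le> n)"
  shows "ce_set C" "satisfies (indicator C) CC" "\<not> satisfies (indicator C) Alpha1"
proof -
  show "ce_set C"
    unfolding C_def by (intro ce_first_zeros computable_intros)
  obtain i where i: "\<And>n. n \<in> C \<Longrightarrow> i n * i n \<le> n" "inj_on i C"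
    unfolding C_def by (rule first_zeros_index[of "\<lambda>e n. e * e \<le> n"]) blast
  have null: "null C"
    unfolding null_def
  proof (intro allI impI)
    fix \<epsilon> :: real assume "0 < \<epsilon>"
    then obtain K :: nat where K: "0 < K" "1 / real K < \<epsilon>"
      using reals_Archimedean[of \<epsilon>] by (metis inverse_eq_divide zero_less_Suc)
    show "small \<epsilon> C"
    proof (rule smallI[OF _ K(2)])
      fix n
      \<comment> \<open>This avoids square roots: a responsible program \<open>i m\<close> is below
        \<open>K\<close>, or \<open>i m * K\<close> is at most its square and hence at most
        \<open>n\<close>. As \<open>K\<close> is arbitrary, the density is 0.\<close>
      have "i ` (C \<inter> {0..<n}) \<subseteq> {0..<K + n div K + 1}"
      proof safe
        fix m assume m: "m \<in> C" "m \<in> {0..<n}"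
        show "i m \<in> {0..<K + n div K + 1}"
        proof (cases "i m < K")
          case False
          have "i m * K \<le> i m * i m" using False by simp
          also have "\<dots> \<le> n" using i(1)[OF m(1)] m(2) by simp
          finally have "i m \<le> n div K" using K(1) by (simp add: less_eq_div_iff_mult_less_eq)
          then show ?thesis by simp
        qed simp
      qed
      then have "card (C \<inter> {0..<n}) \<le> card {0..<K + n div K + 1}"
        by (intro card_inj_on_le[of i]) (auto intro: inj_on_subset[OF i(2)])
      then have "real (card (C \<inter> {0..<n})) \<le> real (n div K) + real (K + 1)" by simp
      also have "real (n div K) \<le> real n / real K" by (rule of_nat_div_le_of_nat)
      finally show "real (card (C \<inter> {0..<n})) \<le> 1 / real K * real n + real (K + 1)" by simp
    qed
  qed
  have "{n. (0::nat) \<noteq> indicator C n} = C" by (auto simp: indicator_def)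
  then show "satisfies (indicator C) CC"
    unfolding CC_iff using null computable_const[of 0] by (intro exI[of _ "\<lambda>n. 0"]) simp
  show "\<not> satisfies (indicator C) Alpha1"
  proof
    assume "satisfies (indicator C) Alpha1"
    then obtain f where f: "partial_computable f" "\<And>n. f n = None \<or> f n = Some (indicator C n)"
        "small (1 / 4) {n. f n = None}"
      unfolding Alpha1_iff by (meson zero_less_divide_1_iff zero_less_numeral)
    obtain e where e: "\<And>n y. f n = Some y \<longleftrightarrow> (\<exists>t. run e n y t)" using run_index[OF f(1)] by blast
    have nz: "f n \<noteq> Some 0" if n: "e * e \<le> n" for n
    proof
      assume "f n = Some 0"
      then obtain t where "run e n 0 t" using e by blast
      moreover have "e \<le> m" if "e * e \<le> m" for m using that le_square[of e] by linarith
      ultimately obtain m t where "m \<in> C" "run e m 0 t"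
        unfolding C_def using first_zeros_meets[of "\<lambda>e n. e * e \<le> n" e n t] n by blast
      then have "f m = Some 0" "m \<in> C" using e by blast+
      then show False using f(2)[of m] by simp
    qed
    have "null (C \<union> {..<e * e})" by (rule null_Un[OF null null_finite]) simp
    then have "small (1 / 4) (C \<union> {..<e * e})" by (simp add: null_def)
    from small_Un[OF f(3) this] have "small (1 / 2) ({n. f n = None} \<union> (C \<union> {..<e * e}))" by simp
    moreover have "n \<in> {n. f n = None} \<union> (C \<union> {..<e * e})" for n
      using f(2)[of n] nz[of n] by (cases "n \<in> C") (auto simp: not_le)
    then have "{n. f n = None} \<union> (C \<union> {..<e * e}) = UNIV" by blast
    ultimately have "small (1 / 2) (UNIV :: nat set)" by simp
    then obtain N where "\<And>n. N \<le> n \<Longrightarrow> real n \<le> 1 / 2 * real n"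
      by (auto simp: small_def eventually_sequentially)
    from this[of "Suc N"] show False by simp
  qed
qed

text \<open>
  Column \<open>e\<close> is filled up to a block whenever program \<open>e\<close> outputs \<open>0\<close> on half of its cell there. So
  every column is finite or full, and the program is wrong on half of infinitely many cells either way.
\<close>

lemma not_DC_example:
  defines "C \<equiv> {n. \<exists>w. n < 2 ^ Suc (pi1 w) \<and>
    card {m. m < 2 ^ Suc (pi1 w) \<and> (2 ^ pi1 w \<le> m \<and> col m = col n)} \<le>
    2 * card {m. m < 2 ^ Suc (pi1 w) \<and> (2 ^ pi1 w \<le> m \<and> col m = col n \<and> run (col n) m 0 (pi2 w))}}"
  shows "ce_set C" "satisfies (indicator C) Alpha1" "\<not> satisfies (indicator C) DC"
proof -
  show "ce_set C"
    unfolding C_def by (intro ce_setI computable_intros computable_col decidable_run)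
  define good where "good e s \<longleftrightarrow> card (cell e s) \<le> 2 * card {m \<in> cell e s. \<exists>t. run e m 0 t}" for e s
  have good: "(\<exists>t. card (cell e s) \<le> 2 * card {m \<in> cell e s. run e m 0 t}) \<longleftrightarrow> good e s" for e s
  proof
    assume "\<exists>t. card (cell e s) \<le> 2 * card {m \<in> cell e s. run e m 0 t}"
    then obtain t where "card (cell e s) \<le> 2 * card {m \<in> cell e s. run e m 0 t}" by blast
    moreover have "card {m \<in> cell e s. run e m 0 t} \<le> card {m \<in> cell e s. \<exists>t. run e m 0 t}"
      by (intro card_mono) auto
    ultimately show "good e s" unfolding good_def by linarith
  next
    assume g: "good e s"
    let ?S = "{m \<in> cell e s. \<exists>t. run e m 0 t}"
    have "\<forall>m\<in>?S. \<exists>t. run e m 0 t" by blast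
    then obtain T where T: "\<And>m. m \<in> ?S \<Longrightarrow> run e m 0 (T m)" by metis
    have "run e m 0 (sum T ?S)" if "m \<in> ?S" for m
    proof -
      have "T m \<le> sum T ?S" using that by (intro member_le_sum) auto
      then show ?thesis using T[OF that] run_mono by blast
    qed
    then have "?S \<subseteq> {m \<in> cell e s. run e m 0 (sum T ?S)}" by blast
    then have "card ?S \<le> card {m \<in> cell e s. run e m 0 (sum T ?S)}" by (intro card_mono) auto
    then show "\<exists>t. card (cell e s) \<le> 2 * card {m \<in> cell e s. run e m 0 t}"
      using g unfolding good_def by (intro exI[of _ "sum T ?S"]) linarith
  qed
  have C_iff: "n \<in> C \<longleftrightarrow> (\<exists>s. n < 2 ^ Suc s \<and> good (col n) s)" for n
  proof -
    have 1: "{m. m < 2 ^ Suc s \<and> (2 ^ s \<le> m \<and> col m = e)} = cell e s"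
      "{m. m < 2 ^ Suc s \<and> (2 ^ s \<le> m \<and> col m = e \<and> R m)} = {m \<in> cell e s. R m}" for s e R
      by (auto simp: cell_def block_def)
    have "n \<in> C \<longleftrightarrow> (\<exists>s t. n < 2 ^ Suc s \<and>
        card (cell (col n) s) \<le> 2 * card {m \<in> cell (col n) s. run (col n) m 0 t})"
    proof -
      have "(\<exists>w. R (pi1 w) (pi2 w)) \<longleftrightarrow> (\<exists>s t. R s t)" for R :: "nat \<Rightarrow> nat \<Rightarrow> bool"
        by (metis pi1_pair pi2_pair)
      from this[of "\<lambda>s t. n < 2 ^ Suc s \<and>
        card (cell (col n) s) \<le> 2 * card {m \<in> cell (col n) s. run (col n) m 0 t}"]
      show ?thesis unfolding C_def mem_Collect_eq 1 .
    qed
    then show ?thesis unfolding good[symmetric] by (simp only: ex_simps)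
  qed
  have full: "n \<in> C" if inf: "infinite {s. good (col n) s}" for n
  proof -
    obtain s where "good (col n) s" "n < s"
      using inf unfolding infinite_nat_iff_unbounded by auto
    moreover have "s < 2 ^ Suc s" by (rule less_le_trans[OF less_exp]) simp
    ultimately show ?thesis unfolding C_iff by (intro exI[of _ s]) simp
  qed
  have fin: "finite {n \<in> C. col n = e}" if "finite {s. good e s}" for e
  proof (rule finite_subset)
    show "{n \<in> C. col n = e} \<subseteq> (\<Union>s\<in>{s. good e s}. {..<2 ^ Suc s})" unfolding C_iff by blast
    show "finite (\<Union>s\<in>{s. good e s}. {..<2 ^ Suc s :: nat})" using that by blast
  qed
  show "satisfies (indicator C) Alpha1"
  proof (rule Alpha1_columns)
    fix e
    show "\<exists>h. computable h \<and> (\<forall>n. col n = e \<longrightarrow> h n = indicator C n)"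
    proof (cases "finite {s. good e s}")
      case True
      have "computable (\<lambda>n. of_bool (n \<in> {n \<in> C. col n = e}))"
        using decidable_finite[OF fin[OF True]] by (simp add: decidable_def)
      then show ?thesis by (intro exI conjI) (auto simp: indicator_def)
    next
      case False
      then show ?thesis using full computable_const[of 1] by (intro exI[of _ "\<lambda>n. 1"]) auto
    qed
  qed
  show "\<not> satisfies (indicator C) DC"
  proof
    assume "satisfies (indicator C) DC"
    then obtain f where f: "partial_computable f" "null {n. f n \<noteq> Some (indicator C n)}"
      unfolding DC_iff by blast
    obtain e where e: "\<And>n y. f n = Some y \<longleftrightarrow> (\<exists>t. run e n y t)" using run_index[OF f(1)] by blast
    let ?B = "{n. f n \<noteq> Some (indicator C n)}"
    let ?Z = "\<lambda>s. {m \<in> cell e s. f m = Some 0}"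
    have good_iff: "good e s \<longleftrightarrow> card (cell e s) \<le> 2 * card (?Z s)" for s
      unfolding good_def e ..
    show False
    proof (cases "finite {s. good e s}")
      case False
      show False
      proof (rule null_frequently_cell[OF f(2)])
        fix N
        obtain s where s: "N \<le> s" "good e s"
          using False unfolding infinite_nat_iff_unbounded_le by auto
        \<comment> \<open>The column lies entirely in \<open>C\<close>, so every output 0 is an
          error.\<close>
        have "?Z s \<subseteq> ?B \<inter> cell e s" using full False by (auto simp: cell_def)
        then have "card (?Z s) \<le> card (?B \<inter> cell e s)" by (intro card_mono) auto
        then show "\<exists>s\<ge>N. card (cell e s) \<le> 2 * card (?B \<inter> cell e s)"
          using s unfolding good_iff by (intro exI[of _ s]) linarith
      qed
    next
      case True
      \<comment> \<open>Once the finitely many elements of \<open>C\<close> in the column are added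
        to the errors, every point of a cell with no output 0 is counted, and from \<open>M\<close>
        on these are more than half.\<close>
      have "null (?B \<union> {n \<in> C. col n = e})"
        by (rule null_Un[OF f(2) null_finite[OF fin[OF True]]])
      then show False
      proof (rule null_frequently_cell)
        fix N
        obtain M where M: "\<forall>s\<in>{s. good e s}. s < M"
          using True finite_nat_set_iff_bounded by blast
        define s where "s = max N M"
        have "\<not> good e s" using M by (force simp: s_def)
        then have *: "2 * card (?Z s) < card (cell e s)" by (simp add: good_iff)
        have "cell e s - ?Z s \<subseteq> (?B \<union> {n \<in> C. col n = e}) \<inter> cell e s"
          by (auto simp: cell_def)
        then have "card (cell e s - ?Z s) \<le> card ((?B \<union> {n \<in> C. col n = e}) \<inter> cell e s)"
          by (intro card_mono) auto
        moreover have "card (cell e s - ?Z s) = card (cell e s) - card (?Z s)"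
          by (intro card_Diff_subset) auto
        ultimately show "\<exists>s\<ge>N. card (cell e s) \<le> 2 * card ((?B \<union> {n \<in> C. col n = e}) \<inter> cell e s)"
          using * by (intro exI[of _ s] conjI) (simp add: s_def, linarith)
      qed
    qed
  qed
qed

section \<open>Assembling the examples along the graph\<close>

lemma below_refl: "p \<preceq> p"
  by (simp add: below_def)

lemma below_edge: "(p, q) \<in> edges \<Longrightarrow> r \<preceq> q \<Longrightarrow> r \<preceq> p"
  unfolding below_def by (auto intro: trancl_into_trancl2)

lemma below_edges:
  "r \<preceq> CC \<Longrightarrow> r \<preceq> EDC" "r \<preceq> GC \<Longrightarrow> r \<preceq> EDC" "r \<preceq> DC \<Longrightarrow> r \<preceq> CC" "r \<preceq> DC \<Longrightarrow> r \<preceq> GC"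
  "r \<preceq> Alpha1 \<Longrightarrow> r \<preceq> GC" "r \<preceq> Gamma1 \<Longrightarrow> r \<preceq> DC" "r \<preceq> Gamma1 \<Longrightarrow> r \<preceq> Alpha1"
  by (rule below_edge; simp add: edges_def)+

lemma satisfies_edges:
  "satisfies g EDC \<Longrightarrow> satisfies g CC" "satisfies g EDC \<Longrightarrow> satisfies g GC"
  "satisfies g CC \<Longrightarrow> satisfies g DC" "satisfies g GC \<Longrightarrow> satisfies g DC"
  "satisfies g GC \<Longrightarrow> satisfies g Alpha1" "satisfies g DC \<Longrightarrow> satisfies g Gamma1"
  "satisfies g Alpha1 \<Longrightarrow> satisfies g Gamma1"
  by (erule satisfies_edge[rotated]; simp add: edges_def)+

text \<open>In each case the properties verified for the example imply, along the edges, all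
  properties that do not imply \<open>q\<close>; for \<gamma> = 1 there are none. That the others
  fail follows from the failure of \<open>q\<close>.\<close>

lemma irreducible_example:
  "\<exists>C. ce_set C \<and> (\<forall>p. satisfies (indicator C) p \<longleftrightarrow> \<not> q \<preceq> p)"
proof -
  have "\<exists>C. ce_set C \<and> \<not> satisfies (indicator C) q \<and> (\<forall>p. \<not> q \<preceq> p \<longrightarrow> satisfies (indicator C) p)"
  proof (cases q)
    case EDC
    have "satisfies g p" if "satisfies g GC" "satisfies g CC" "\<not> EDC \<preceq> p" for g p
      using that satisfies_edges[of g] below_refl[of EDC]
        by (cases p) (simp_all only: simp_thms)
    then show ?thesis unfolding EDC using not_EDC_example by blast
  next
    case CC
    have "satisfies g p" if "satisfies g GC" "\<not> CC \<preceq> p" for g p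
      using that satisfies_edges[of g] below_refl[of CC] below_edges[of CC]
        by (cases p) (simp_all only: simp_thms)
    then show ?thesis unfolding CC using not_CC_example by blast
  next
    case GC
    have "satisfies g p" if "satisfies g CC" "satisfies g Alpha1" "\<not> GC \<preceq> p" for g p
      using that satisfies_edges[of g] below_refl[of GC] below_edges[of GC]
        by (cases p) (simp_all only: simp_thms)
    then show ?thesis unfolding GC using not_GC_example by blast
  next
    case DC
    have "satisfies g p" if "satisfies g Alpha1" "\<not> DC \<preceq> p" for g p
      using that satisfies_edges[of g] below_refl[of DC] below_edges[of DC]
        by (cases p) (simp_all only: simp_thms)
    then show ?thesis unfolding DC using not_DC_example by blast
  next
    case Alpha1
    have "satisfies g p" if "satisfies g CC" "\<not> Alpha1 \<preceq> p" for g p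
      using that satisfies_edges[of g] below_refl[of Alpha1] below_edges[of Alpha1]
        by (cases p) (simp_all only: simp_thms)
    then show ?thesis unfolding Alpha1 using not_Alpha1_example by blast
  next
    case Gamma1
    have "Gamma1 \<preceq> p" for p
      using below_refl[of Gamma1] below_edges[of Gamma1]
        by (cases p) (simp_all only: simp_thms)
    then show ?thesis unfolding Gamma1 using not_Gamma1_example by blast
  qed
  then show ?thesis using satisfies_below by metis
qed

lemma exact_example:
  assumes "finite Q"
  shows "\<exists>C. ce_set C \<and> (\<forall>p. satisfies (indicator C) p \<longleftrightarrow> (\<forall>q\<in>Q. \<not> q \<preceq> p))"
  using assms
proof (induction Q rule: finite_induct)
  case empty
  \<comment> \<open>The constant 1 is \<open>box_code (Val 0)\<close>, a correct answer
    everywhere.\<close>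
  have "satisfies (indicator {}) EDC"
    unfolding EDC_iff using computable_const[of 1] null_finite[of "{}"] by (intro exI[of _ "\<lambda>n. 1"]) simp
  then have "satisfies (indicator {}) p" for p
    using satisfies_edges[of "indicator {}"]
        by (cases p) (simp_all only: simp_thms)
  moreover have "ce_set {}"
    using ce_setI[OF decidable_const[of False]] by simp
  ultimately show ?case by blast
next
  case (insert q Q)
  then obtain A where A: "ce_set A" "\<And>p. satisfies (indicator A) p \<longleftrightarrow> (\<forall>q\<in>Q. \<not> q \<preceq> p)" by blast
  obtain B where B: "ce_set B" "\<And>p. satisfies (indicator B) p \<longleftrightarrow> \<not> q \<preceq> p"
    using irreducible_example by blast
  obtain C where "ce_set C" "(indicator C :: nat \<Rightarrow> nat) = interleave (indicator A) (indicator B)"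
    using ce_set_interleave[OF A(1) B(1)] by blast
  then show ?case using A(2) B(2) by (intro exI[of _ C]) (auto simp: satisfies_interleave simp del: satisfies.simps)
qed

theorem theorem2p5:
  fixes P Q :: "property set"
  shows "((\<exists>C. ce_set C \<and> separates (indicator C) P Q) \<longleftrightarrow>
            (\<exists>C :: nat set. separates (indicator C) P Q)) \<and>
         ((\<exists>C :: nat set. separates (indicator C) P Q) \<longleftrightarrow>
            (\<exists>g :: nat \<Rightarrow> nat. separates g P Q)) \<and>
         ((\<exists>g :: nat \<Rightarrow> nat. separates g P Q) \<longleftrightarrow>
            \<not> (\<exists>p\<in>P. \<exists>q\<in>Q. q \<preceq> p))"
proof -
  have "\<not> (\<exists>p\<in>P. \<exists>q\<in>Q. q \<preceq> p)" if "separates g P Q" for g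
    using that satisfies_below[of _ _ g] unfolding separates_def by blast
  moreover have "\<exists>C. ce_set C \<and> separates (indicator C) P Q" if "\<not> (\<exists>p\<in>P. \<exists>q\<in>Q. q \<preceq> p)"
  proof -
    have "p \<in> {EDC, CC, GC, DC, Alpha1, Gamma1}" for p by (cases p) simp_all
    then have "finite Q" by (meson finite.emptyI finite.insertI finite_subset subsetI)
    then obtain C where "ce_set C" "\<And>p. satisfies (indicator C) p \<longleftrightarrow> (\<forall>q\<in>Q. \<not> q \<preceq> p)"
      using exact_example by blast
    then show ?thesis
      using that below_refl unfolding separates_def by (intro exI[of _ C]) blast
  qed
  ultimately show ?thesis by blast
qed

end
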